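(* Let $$X_{24}=\{\pm e_1,\ldots,\pm e_4\}\cup\left\{\tfrac12(\varepsilon_1,\varepsilon_2,\varepsilon_3,\varepsilon_4):\varepsilon_i\in\{\pm1\}\right\}\subset\mathbb S^3,$$ let $P$ be its Steiner-normalized Minkowski polytope, and let $r,R$ be the centered inradius and circumradius of $P$. Then $$\frac rR=\eta_{5,4}=\frac1{\sqrt2}.$$ Every facet row realizes the three-node Gaussian rule with nodes $-\frac1{\sqrt2},0,\frac1{\sqrt2}$ and weights $(1/4,1/2,1/4)$; that is, for every $x\in X_{24}$ the numbers $\langle Ux,y\rangle$, $y\in X_{24}$, take the values $-\frac1{\sqrt2},0,\frac1{\sqrt2}$ exactly $6$, $12$, $6$ times, respectively, where $$U=\frac1{\sqrt2}\begin{pmatrix}1&1&0&0\\1&-1&0&0\\0&0&1&1\\0&0&1&-1\end{pmatrix}.$$ Moreover every facet of $P$ has six vertices.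
   Context: $X_{24}$ has $24$ points, is the vertex set of a regular $24$-cell, and is a spherical $5$-design: $\frac1{24}\sum_{x\in X_{24}}p(x)=\int_{\mathbb S^3}p\,d\sigma$ for every polynomial $p$ of degree at most $5$, where $\sigma$ is the normalized (probability) surface measure on the unit sphere $\mathbb S^3\subset\mathbb R^4$. Its Minkowski polytope $P$ is the full-dimensional convex polytope in $\mathbb R^4$, unique up to translation, with exactly $24$ facets, whose outer unit normals are the points of $X_{24}$ and whose facets all have the same $3$-volume $\omega_3/24$, $\omega_3=2\pi^2$ being the total surface measure of $\mathbb S^3$. Steiner-normalized means the translate is chosen so that the Steiner point $4\int_{\mathbb S^3}h_P(u)u\,d\sigma(u)$ is $0$, with $h_P(u)=\max_{y\in P}\langle u,y\rangle$. The centered inradius $r$ is the largest radius of an origin-centered ball contained in $P$, the centered circumradius $R$ the smallest radius of an origin-centered ball containing $P$. The matrix $U$ is the orthogonal map realizing the self-polarity $P^\circ=cUP$ (some $c>0$), where $P^\circ=\{z:\langle z,y\rangle\le1\ \forall y\in P\}$; the "facet row" indexed by the facet with outer normal $x$ is the family $(\langle Ux,y\rangle)_{y\in X_{24}}$. $\eta_{5,4}$ is the largest zero of the degree-$3$ orthogonal polynomial for the probability measure on $[-1,1]$ with density proportional to $(1-s^2)^{1/2}$ (the distribution of the first coordinate of a uniform point on $\mathbb S^3$); the three-node Gaussian rule for this measure has the zeros of that polynomial as nodes. *)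

theory Defs
  imports "HOL-Analysis.Analysis" "HOL-Computational_Algebra.Polynomial"
begin

definition X24 :: "(real^4) set" where
  "X24 = {axis i 1 | i. True} \<union> {- axis i 1 | i. True}
       \<union> {(1/2) *\<^sub>R \<epsilon> | \<epsilon>. \<forall>i. \<epsilon> $ i \<in> {-1, 1}}"

definition U24 :: "real^4^4" where
  "U24 = (1 / sqrt 2) *\<^sub>R vector [vector [1,  1, 0,  0],
                                vector [1, -1, 0,  0],
                                vector [0,  0, 1,  1],
                                vector [0,  0, 1, -1]]"

text \<open>
  The normalized surface measure on the unit sphere, as a Borel measure on the ambient space:
  the measure of \<open>A\<close> is the relative volume in the unit ball of the cone
  \<open>{t u | u \<in> A, 0 < t < 1}\<close>. Recall that \<open>sgn x\<close> is \<open>x / norm x\<close> (and \<open>sgn 0 = 0\<close>,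
  which is a null event).
\<close>
definition sphere_measure :: "(real^4) measure" where
  "sphere_measure = distr (uniform_measure lborel (ball 0 1)) borel sgn"

definition support_fun :: "(real^4) set \<Rightarrow> real^4 \<Rightarrow> real" where
  "support_fun P u = (SUP y\<in>P. u \<bullet> y)"

definition steiner_point :: "(real^4) set \<Rightarrow> real^4" where
  "steiner_point P = 4 *\<^sub>R (\<integral>u. support_fun P u *\<^sub>R u \<partial>sphere_measure)"

text \<open>
  The 3-dimensional volume of a subset \<open>F\<close> of a hyperplane: Lebesgue measure in isometric
  coordinates on a hyperplane containing \<open>F\<close>. The value does not depend on the choice of the
  coordinates; it is only meaningful if \<open>F\<close> lies in a hyperplane.
\<close>
definition volume3 :: "(real^4) set \<Rightarrow> real" where
  "volume3 F = measure lborel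
     ((SOME f :: real^3 \<Rightarrow> real^4. (\<forall>x y. dist (f x) (f y) = dist x y) \<and> F \<subseteq> range f) -` F)"

definition outer_unit_normal :: "(real^4) set \<Rightarrow> (real^4) set \<Rightarrow> real^4 \<Rightarrow> bool" where
  "outer_unit_normal P F u \<longleftrightarrow> norm u = 1 \<and> F = {y \<in> P. u \<bullet> y = support_fun P u}"

text \<open>The constant \<open>2 * pi^2\<close> is the total surface measure of the unit sphere of \<open>real^4\<close>.\<close>
definition minkowski_polytope :: "(real^4) set \<Rightarrow> (real^4) set \<Rightarrow> bool" where
  "minkowski_polytope X P \<longleftrightarrow>
     polytope P \<and> aff_dim P = 4 \<and>
     card {F. F facet_of P} = card X \<and>
     {u. \<exists>F. F facet_of P \<and> outer_unit_normal P F u} = X \<and>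
     (\<forall>F. F facet_of P \<longrightarrow> volume3 F = 2 * pi^2 / card X)"

definition centered_inradius :: "(real^4) set \<Rightarrow> real" where
  "centered_inradius P = (GREATEST \<rho>. 0 \<le> \<rho> \<and> cball 0 \<rho> \<subseteq> P)"

definition centered_circumradius :: "(real^4) set \<Rightarrow> real" where
  "centered_circumradius P = (LEAST \<rho>. 0 \<le> \<rho> \<and> P \<subseteq> cball 0 \<rho>)"

definition polar_body :: "(real^4) set \<Rightarrow> (real^4) set" where
  "polar_body P = {z. \<forall>y\<in>P. z \<bullet> y \<le> 1}"

text \<open>The distribution of one coordinate of a uniform point on the unit sphere of \<open>real^4\<close>.\<close>
definition coord_measure :: "real measure" where
  "coord_measure = density lborel
     (\<lambda>s. ennreal (indicator {-1..1} s * sqrt (1 - s^2) / integral {-1..1} (\<lambda>t. sqrt (1 - t^2))))"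

definition monic_orth_poly :: "real measure \<Rightarrow> nat \<Rightarrow> real poly" where
  "monic_orth_poly \<mu> n = (THE p. degree p = n \<and> lead_coeff p = 1 \<and>
     (\<forall>q. degree q < n \<longrightarrow> (\<integral>s. poly p s * poly q s \<partial>\<mu>) = 0))"

definition eta_5_4 :: real where
  "eta_5_4 = Max {s. poly (monic_orth_poly coord_measure 3) s = 0}"

text \<open>
  A quadrature rule is a list of pairs (node, weight). A Gaussian rule has the zeros of the
  orthogonal polynomial as nodes and is exact up to degree one less than twice the number of nodes.
\<close>
definition gaussian_rule :: "real measure \<Rightarrow> (real \<times> real) list \<Rightarrow> bool" where
  "gaussian_rule \<mu> Q \<longleftrightarrow>
     distinct (map fst Q) \<and>
     fst ` set Q = {s. poly (monic_orth_poly \<mu> (length Q)) s = 0} \<and>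
     (\<forall>p. degree p < 2 * length Q \<longrightarrow>
        (\<integral>s. poly p s \<partial>\<mu>) = (\<Sum>(s, w)\<leftarrow>Q. w * poly p s))"

text \<open>
  The family \<open>f y\<close>, \<open>y \<in> Y\<close>, takes exactly the nodes as values, each with relative
  frequency equal to its weight.
\<close>
definition realizes_rule :: "'a set \<Rightarrow> ('a \<Rightarrow> real) \<Rightarrow> (real \<times> real) list \<Rightarrow> bool" where
  "realizes_rule Y f Q \<longleftrightarrow>
     f ` Y = fst ` set Q \<and>
     (\<forall>(s, w) \<in> set Q. real (card {y \<in> Y. f y = s}) / real (card Y) = w)"

end

theory Submission
  imports Defs
begin

text \<open>
  The heart of the matter is that \<open>P\<close> is a dilate of the 24-cell. Once this is known, every
  claim is a computation with the 24 normals and the 24 vertices \<open>\<plusminus>e\<^sub>i \<plusminus> e\<^sub>j\<close>, and with the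
  moments of the semicircle density.

  That \<open>P\<close> is determined by its normals and facet volumes is Minkowski's uniqueness theorem,
  usually derived from the equality case of the Brunn-Minkowski inequality. Here symmetry gives
  a shorter way. For \<open>u\<close> in \<open>X24\<close> let \<open>\<rho>\<close> be the reflection in the hyperplane orthogonal
  to \<open>u\<close>; it permutes \<open>X24\<close>. Let \<open>h\<close> be the support function of \<open>P\<close>. Seen along \<open>u\<close>, the
  polytope lies between a concave upper graph \<open>f\<close> and a convex lower graph \<open>-g\<close> over its
  projection \<open>D\<close>. The facets with \<open>u \<bullet> v > 0\<close> project onto tiles \<open>T v\<close> that tile \<open>D\<close>, and so
  do the mirror facets, with normals \<open>\<rho> v\<close>, which project onto tiles \<open>T' v\<close>. The two
  tiles of \<open>v\<close> have the same volume, namely \<open>u \<bullet> v\<close> times the common facet volume. Put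
  \<open>\<phi> = g - f\<close> and \<open>\<delta> v = (h (\<rho> v) - h v) / (u \<bullet> v)\<close>. Since \<open>f\<close> and \<open>g\<close> are minima of the
  affine functions that describe the facets, \<open>\<phi> \<le> \<delta> v\<close> on \<open>T v\<close> and \<open>\<phi> \<ge> \<delta> v\<close> on \<open>T' v\<close>.
  Comparing the two tilings forces equality on every \<open>T v\<close>, so that \<open>\<phi>\<close> takes finitely many
  values on the connected set \<open>D\<close> and is a constant \<open>c\<close> (\<open>two_tilings_constant\<close>). This says
  that \<open>\<rho> P = P + c u\<close> (\<open>reflection_rigidity\<close>), and the Steiner point at the origin rules out
  \<open>c \<noteq> 0\<close> (\<open>steiner_point_zero_no_drift\<close>).

  Hence \<open>h\<close> is invariant under all these reflections. They act transitively on \<open>X24\<close>, so \<open>h\<close>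
  is constant there, and \<open>P\<close> is a dilate of \<open>cell24\<close>
  (\<open>minkowski_polytope_X24_is_cell24\<close>).
\<close>

section \<open>Reflections, isometries and projections of facets\<close>

definition reflect :: "'a::real_inner \<Rightarrow> 'a \<Rightarrow> 'a" where
  "reflect u y = y - (2 * (u \<bullet> y)) *\<^sub>R u"

lemma inner_reflect: "norm u = 1 \<Longrightarrow> u \<bullet> reflect u y = - (u \<bullet> y)"
  by (simp add: reflect_def inner_diff_right norm_eq_1)

lemma reflect_reflect: "norm u = 1 \<Longrightarrow> reflect u (reflect u y) = y"
  by (simp add: reflect_def inner_diff_right norm_eq_1 algebra_simps)

lemma reflect_inner_right: "reflect u x \<bullet> y = x \<bullet> reflect u y"
  by (simp add: reflect_def inner_diff_right inner_diff_left inner_commute)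

lemma linear_reflect: "linear (reflect u)"
  by (rule linearI) (simp_all add: reflect_def inner_add_right algebra_simps)

lemma reflect_inner_reflect: "norm u = 1 \<Longrightarrow> reflect u x \<bullet> reflect u y = x \<bullet> y"
  by (simp add: reflect_inner_right reflect_reflect)

lemma norm_preserving_imp_inner:
  assumes "linear L" "\<And>x. norm (L x) = norm x"
  shows "L x \<bullet> L y = x \<bullet> y"
  by (simp add: dot_norm assms(2) flip: linear_add[OF assms(1)])

lemma inner_preserving_imp_linear:
  fixes L :: "'a::real_inner \<Rightarrow> 'b::real_inner"
  assumes i: "\<And>x y. L x \<bullet> L y = x \<bullet> y"
  shows "linear L"
proof (rule linearI)
  have z: "w \<bullet> w = 0 \<Longrightarrow> w = 0" for w :: 'b by simp
  show "L (x + y) = L x + L y" for x y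
  proof -
    have "(L (x + y) - L x - L y) \<bullet> (L (x + y) - L x - L y) = 0"
      unfolding inner_diff_left inner_diff_right i by (simp add: inner_add_left inner_add_right algebra_simps)
    from z[OF this] show ?thesis by (simp add: algebra_simps)
  qed
  show "L (r *\<^sub>R x) = r *\<^sub>R L x" for r x
  proof -
    have "(L (r *\<^sub>R x) - r *\<^sub>R L x) \<bullet> (L (r *\<^sub>R x) - r *\<^sub>R L x) = 0"
      unfolding inner_diff_left inner_diff_right inner_scaleR_left inner_scaleR_right i
      by (simp add: algebra_simps)
    from z[OF this] show ?thesis by simp
  qed
qed

text \<open>
  Makes the coordinates chosen by \<open>volume3\<close>, of which only the preservation of distances is
  known, accessible to linear algebra.
\<close>
lemma isometry_translation_linear:
  fixes f :: "'a::euclidean_space \<Rightarrow> 'b::euclidean_space"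
  assumes iso: "\<And>x y. dist (f x) (f y) = dist x y"
  obtains L where "linear L" "\<And>x. norm (L x) = norm x" "\<And>x. f x = f 0 + L x"
proof
  let ?L = "\<lambda>x. f x - f 0"
  show n: "norm (?L x) = norm x" for x using iso[of x 0] by (simp add: dist_norm)
  have d: "norm (?L x - ?L y) = norm (x - y)" for x y using iso[of x y] by (simp add: dist_norm)
  show "linear ?L" by (rule inner_preserving_imp_linear) (simp only: dot_norm_neg n d)
  show "f x = f 0 + ?L x" for x by simp
qed

lemma hyperplane_coordinates:
  fixes u :: "real^4"
  assumes "norm u = 1"
  obtains \<iota> :: "real^3 \<Rightarrow> real^4"
    where "linear \<iota>" "\<And>x. norm (\<iota> x) = norm x" "range \<iota> = {y. u \<bullet> y = 0}"
proof -
  have "u \<noteq> 0" using assms by auto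
  hence "dim (UNIV :: (real^3) set) = dim {y. u \<bullet> y = 0}"
    by (simp add: dim_hyperplane)
  then show ?thesis
  proof (rule isometry_subspaces[OF subspace_UNIV subspace_hyperplane])
    fix f :: "real^3 \<Rightarrow> real^4"
    assume "linear f" "range f = {y. u \<bullet> y = 0}" "\<And>x. x \<in> UNIV \<Longrightarrow> norm (f x) = norm x"
    thus ?thesis by (intro that) auto
  qed
qed

text \<open>
  The adjoint of isometric coordinates on the hyperplane orthogonal to \<open>u\<close> is the orthogonal
  projection along \<open>u\<close>, read in these coordinates.
\<close>
lemma adjoint_hyperplane_coordinates:
  fixes \<iota> :: "real^'n \<Rightarrow> real^'m"
  assumes "linear \<iota>" "\<And>x. norm (\<iota> x) = norm x" "range \<iota> = {y. u \<bullet> y = 0}" "norm u = 1"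
  shows "\<iota> (adjoint \<iota> y) = y - (u \<bullet> y) *\<^sub>R u"
    and "adjoint \<iota> (\<iota> x) = x"
    and "adjoint \<iota> u = 0"
    and "adjoint \<iota> y \<bullet> adjoint \<iota> w = y \<bullet> w - (u \<bullet> y) * (u \<bullet> w)"
proof -
  note inn = norm_preserving_imp_inner[OF assms(1,2)]
  have ad: "x \<bullet> adjoint \<iota> y = \<iota> x \<bullet> y" for x y by (rule adjoint_works[OF assms(1)])
  have lin: "linear (adjoint \<iota>)" by (rule adjoint_linear[OF assms(1)])
  show 1: "adjoint \<iota> (\<iota> x) = x" for x
    by (rule vector_eq_rdot[THEN iffD1]) (simp add: inner_commute ad inn)
  have perp: "u \<bullet> \<iota> x = 0" for x using assms(3) by auto
  have "adjoint \<iota> u \<bullet> adjoint \<iota> u = 0" unfolding ad using perp by (simp add: inner_commute)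
  thus 2: "adjoint \<iota> u = 0" by simp
  have "u \<bullet> (y - (u \<bullet> y) *\<^sub>R u) = 0" for y using assms(4) by (simp add: inner_diff_right norm_eq_1)
  hence "\<exists>x. y - (u \<bullet> y) *\<^sub>R u = \<iota> x" for y using assms(3) by auto
  moreover have "adjoint \<iota> (y - (u \<bullet> y) *\<^sub>R u) = adjoint \<iota> y" for y
    by (simp add: linear_diff[OF lin] linear_scale[OF lin] 2)
  ultimately show 3: "\<iota> (adjoint \<iota> y) = y - (u \<bullet> y) *\<^sub>R u" for y by (metis 1)
  show "adjoint \<iota> y \<bullet> adjoint \<iota> w = y \<bullet> w - (u \<bullet> y) * (u \<bullet> w)"
    unfolding ad 3 by (simp add: inner_diff_left)
qed

text \<open>
  The orthogonal projection along \<open>u\<close> scales volumes in the hyperplane with normal \<open>v\<close> by the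
  cosine \<open>\<bar>u \<bullet> v\<bar>\<close>. Indeed, if \<open>A\<close> is its matrix in isometric coordinates, then
  \<open>A\<^sup>T A = I - p p\<^sup>T\<close>, where \<open>p\<close> is the component of \<open>u\<close> inside that hyperplane, and
  \<open>det (I - p p\<^sup>T) = 1 - \<bar>p\<bar>\<^sup>2 = (u \<bullet> v)\<^sup>2\<close>.
\<close>
lemma det_projection_between_hyperplanes:
  fixes \<iota> L :: "real^3 \<Rightarrow> real^4"
  assumes \<iota>: "linear \<iota>" "\<And>x. norm (\<iota> x) = norm x" "range \<iota> = {y. u \<bullet> y = 0}" "norm u = 1"
    and L: "linear L" "\<And>x. norm (L x) = norm x" "range L = {y. v \<bullet> y = 0}" "norm v = 1"
  shows "\<bar>det (matrix (adjoint \<iota> \<circ> L))\<bar> = \<bar>u \<bullet> v\<bar>"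
proof -
  let ?M = "adjoint \<iota> \<circ> L" and ?p = "adjoint L u"
  define A where "A = matrix ?M"
  have pc: "u \<bullet> L (axis i 1) = ?p $ i" for i
    using adjoint_works[OF L(1), of "axis i 1" u] by (simp add: inner_commute[of u] inner_axis')
  have col: "(\<Sum>k\<in>UNIV. A $ k $ i * A $ k $ j) = (if i = j then 1 else 0) - ?p $ i * ?p $ j" for i j
  proof -
    have "(\<Sum>k\<in>UNIV. A $ k $ i * A $ k $ j) = ?M (axis i 1) \<bullet> ?M (axis j 1)"
      by (simp add: A_def matrix_def inner_vec_def)
    also have "\<dots> = L (axis i 1) \<bullet> L (axis j 1) - (u \<bullet> L (axis i 1)) * (u \<bullet> L (axis j 1))"
      unfolding comp_apply by (rule adjoint_hyperplane_coordinates(4)[OF \<iota>])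
    also have "\<dots> = L (axis i 1) \<bullet> L (axis j 1) - ?p $ i * ?p $ j" unfolding pc ..
    also have "L (axis i 1) \<bullet> L (axis j 1) = (if i = j then 1 else 0)"
      by (simp add: norm_preserving_imp_inner[OF L(1,2)] inner_axis_axis)
    finally show ?thesis .
  qed
  have "(norm ?p)\<^sup>2 = 1 - (u \<bullet> v)\<^sup>2"
    using adjoint_hyperplane_coordinates(4)[OF L, of u u] \<iota>(4)
    unfolding power2_norm_eq_inner by (simp add: norm_eq_1 power2_eq_square inner_commute)
  hence p: "(?p $ 1)\<^sup>2 + (?p $ 2)\<^sup>2 + (?p $ 3)\<^sup>2 = 1 - (u \<bullet> v)\<^sup>2"
    unfolding power2_norm_eq_inner inner_vec_def[of ?p] sum_3 by (simp add: power2_eq_square)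
  have "(det A)\<^sup>2 = det (transpose A ** A)"
    by (simp add: det_mul power2_eq_square)
  also have "\<dots> = det (\<chi> i j. (if i = j then 1 else 0) - ?p $ i * ?p $ j)"
    by (simp add: matrix_matrix_mult_def transpose_def col)
  also have "\<dots> = 1 - ((?p $ 1)\<^sup>2 + (?p $ 2)\<^sup>2 + (?p $ 3)\<^sup>2)"
    unfolding det_3 by (simp add: algebra_simps power2_eq_square)
  also have "\<dots> = (u \<bullet> v)\<^sup>2" unfolding p by simp
  finally show ?thesis unfolding A_def by (simp add: power2_eq_iff abs_eq_iff)
qed

lemma hyperplane_linear_isometry_onto:
  fixes L :: "real^3 \<Rightarrow> real^4"
  assumes "linear L" "\<And>x. norm (L x) = norm x" "\<And>x. v \<bullet> L x = 0" "v \<noteq> 0"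
  shows "range L = {y. v \<bullet> y = 0}"
proof (rule subspace_dim_equal)
  show "subspace (range L)" by (rule linear_subspace_image[OF assms(1) subspace_UNIV])
  show "subspace {y. v \<bullet> y = 0}" by (rule subspace_hyperplane)
  show "range L \<subseteq> {y. v \<bullet> y = 0}" using assms(3) by auto
  have "inj L" using assms(1,2) by (metis linear_injective_0 norm_eq_zero)
  hence "dim (range L) = dim (UNIV :: (real^3) set)" by (intro dim_image_eq) (use assms(1) in \<open>auto simp: inj_on_def\<close>)
  thus "dim {y. v \<bullet> y = 0} \<le> dim (range L)" using assms(4) by (simp add: dim_hyperplane)
qed

text \<open>
  Links the facet volumes to Lebesgue measure on the projection. A set of nonzero volume cannot
  lie in an affine subspace of dimension 2, so the coordinates chosen by \<open>volume3\<close> must span exactly the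
  hyperplane that contains \<open>F\<close>, and \<open>det_projection_between_hyperplanes\<close> applies.
\<close>
lemma measure_projection_facet:
  fixes \<iota> :: "real^3 \<Rightarrow> real^4"
  assumes \<iota>: "linear \<iota>" "\<And>x. norm (\<iota> x) = norm x" "range \<iota> = {y. u \<bullet> y = 0}" "norm u = 1"
    and F: "compact F" "F \<subseteq> {y. v \<bullet> y = b}" and v: "norm v = 1" and pos: "volume3 F \<noteq> 0"
  shows "measure lebesgue (adjoint \<iota> ` F) = \<bar>u \<bullet> v\<bar> * volume3 F"
proof -
  define f where "f = (SOME f :: real^3 \<Rightarrow> real^4. (\<forall>x y. dist (f x) (f y) = dist x y) \<and> F \<subseteq> range f)"
  have "\<exists>f :: real^3 \<Rightarrow> real^4. (\<forall>x y. dist (f x) (f y) = dist x y) \<and> F \<subseteq> range f"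
  proof -
    obtain k :: "real^3 \<Rightarrow> real^4" where k: "linear k" "\<And>x. norm (k x) = norm x" "range k = {y. v \<bullet> y = 0}"
      using hyperplane_coordinates[OF v] by blast
    have "dist (b *\<^sub>R v + k x) (b *\<^sub>R v + k y) = dist x y" for x y
      by (simp add: dist_norm k(2) flip: linear_diff[OF k(1)])
    moreover have "F \<subseteq> range (\<lambda>x. b *\<^sub>R v + k x)"
    proof
      fix y assume "y \<in> F"
      hence "v \<bullet> (y - b *\<^sub>R v) = 0" using F(2) v by (auto simp: inner_diff_right norm_eq_1)
      then obtain x where "y - b *\<^sub>R v = k x" using k(3) by auto
      thus "y \<in> range (\<lambda>x. b *\<^sub>R v + k x)" by (auto simp: algebra_simps intro!: image_eqI[of _ _ x])
    qed
    ultimately show ?thesis by (intro exI[of _ "\<lambda>x. b *\<^sub>R v + k x"]) simp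
  qed
  hence "(\<forall>x y. dist (f x) (f y) = dist x y) \<and> F \<subseteq> range f" unfolding f_def by (rule someI_ex)
  hence iso: "dist (f x) (f y) = dist x y" and sub: "F \<subseteq> range f" for x y by auto
  obtain L where L: "linear L" "\<And>x. norm (L x) = norm x" and fL: "\<And>x. f x = f 0 + L x"
    using isometry_translation_linear[of f] iso by blast
  define G where "G = f -` F"
  have contf: "continuous_on UNIV f"
    by (rule lipschitz_on_continuous_on[of 1]) (auto simp: lipschitz_on_def iso)
  have "closed G" unfolding G_def using compact_imp_closed[OF F(1)] contf by (simp add: continuous_closed_vimage continuous_on_eq_continuous_at)
  moreover have "bounded G"
  proof -
    obtain B where B: "\<And>y. y \<in> F \<Longrightarrow> dist (f 0) y \<le> B"
      using compact_imp_bounded[OF F(1)] bounded_any_center[of F "f 0"] by auto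
    have "dist 0 x \<le> B" if "x \<in> G" for x using B[of "f x"] that iso[of 0 x] by (simp add: G_def)
    thus ?thesis unfolding bounded_def by blast
  qed
  ultimately have G: "compact G" by (simp add: compact_eq_bounded_closed)
  hence Gm: "G \<in> lmeasurable" by (rule lmeasurable_compact)
  have vol: "volume3 F = measure lebesgue G"
    unfolding volume3_def f_def[symmetric] G_def[symmetric]
    using G by (simp add: measure_completion borel_compact)
  have FG: "F = f ` G" using sub by (auto simp: G_def)
  \<comment> \<open>Otherwise \<open>G\<close> would lie in a plane, and its volume would vanish.\<close>
  have perp: "v \<bullet> L x = 0" for x
  proof (rule ccontr)
    assume "v \<bullet> L x \<noteq> 0"
    hence "adjoint L v \<noteq> 0" using adjoint_works[OF L(1), of x v] by (auto simp: inner_commute)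
    moreover have "G \<subseteq> {x. adjoint L v \<bullet> x = b - v \<bullet> f 0}"
    proof
      fix x assume "x \<in> G"
      hence "v \<bullet> f x = b" using F(2) by (auto simp: G_def)
      hence "v \<bullet> f 0 + v \<bullet> L x = b" by (subst (asm) fL) (simp add: inner_add_right)
      thus "x \<in> {x. adjoint L v \<bullet> x = b - v \<bullet> f 0}"
        using adjoint_works[OF L(1), of x v] by (simp add: inner_commute)
    qed
    ultimately have "negligible G" using negligible_hyperplane negligible_subset by blast
    thus False using pos unfolding vol by (simp add: negligible_imp_measure0)
  qed
  have "v \<noteq> 0" using v by auto
  note rL = hyperplane_linear_isometry_onto[OF L perp this]
  have lin: "linear (adjoint \<iota>)" by (rule adjoint_linear[OF \<iota>(1)])
  have "adjoint \<iota> ` F = (+) (adjoint \<iota> (f 0)) ` ((adjoint \<iota> \<circ> L) ` G)"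
    unfolding FG image_image comp_apply using fL by (metis linear_add[OF lin])
  hence "measure lebesgue (adjoint \<iota> ` F) = measure lebesgue ((adjoint \<iota> \<circ> L) ` G)"
    by (simp add: measure_translation)
  also have "\<dots> = \<bar>u \<bullet> v\<bar> * measure lebesgue G"
    using measure_linear_image[OF linear_compose[OF L(1) lin] Gm]
      det_projection_between_hyperplanes[OF \<iota> L rL v] by simp
  finally show ?thesis using vol by simp
qed

section \<open>Two tilings of a convex set\<close>

text \<open>
  Integrating \<open>\<phi>\<close> over the two tilings gives
  \<open>\<integral>\<phi> \<le> \<Sum>\<delta> i |T i| = \<Sum>\<delta> i |T' i| \<le> \<integral>\<phi>\<close>, so \<open>\<phi> = \<delta> i\<close> on \<open>T i\<close>, and a continuous
  function with finitely many values on a connected set is constant. The proof compares volumes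
  at a single level \<open>\<alpha>\<close> in place of integrals: the tiles \<open>T i\<close> with \<open>\<delta> i \<le> \<alpha>\<close> and the tiles
  \<open>T' i\<close> with \<open>\<delta> i > \<alpha>\<close> do not overlap and have total volume \<open>|D|\<close>, which leaves no room for
  an open set where \<open>\<phi> < \<alpha> < \<delta> i\<close> inside some \<open>T i\<close>.
\<close>
lemma two_tilings_constant:
  fixes \<phi> :: "'a::euclidean_space \<Rightarrow> real" and D :: "'a set" and T T' :: "'i \<Rightarrow> 'a set"
  assumes fin: "finite I"
    and D: "convex D" "compact D" "D = \<Union>(T ` I)" and cont: "continuous_on D \<phi>"
    and T: "\<And>i. i \<in> I \<Longrightarrow> compact (T i) \<and> convex (T i)"
    and T': "\<And>i. i \<in> I \<Longrightarrow> compact (T' i) \<and> T' i \<subseteq> D"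
    and tiling: "\<And>i j. i \<in> I \<Longrightarrow> j \<in> I \<Longrightarrow> i \<noteq> j \<Longrightarrow> negligible (T i \<inter> T j)"
      "\<And>i j. i \<in> I \<Longrightarrow> j \<in> I \<Longrightarrow> i \<noteq> j \<Longrightarrow> negligible (T' i \<inter> T' j)"
    and meas: "\<And>i. i \<in> I \<Longrightarrow> measure lebesgue (T i) > 0"
      "\<And>i. i \<in> I \<Longrightarrow> measure lebesgue (T' i) = measure lebesgue (T i)"
    and le: "\<And>i x. i \<in> I \<Longrightarrow> x \<in> T i \<Longrightarrow> \<phi> x \<le> \<delta> i"
    and ge: "\<And>i x. i \<in> I \<Longrightarrow> x \<in> T' i \<Longrightarrow> \<delta> i \<le> \<phi> x"
  obtains c where "\<And>i. i \<in> I \<Longrightarrow> \<delta> i = c"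
proof -
  have eq: "\<phi> x = \<delta> i" if i: "i \<in> I" and x: "x \<in> T i" for i x
  proof (rule ccontr)
    assume "\<phi> x \<noteq> \<delta> i"
    hence "\<phi> x < \<delta> i" using le[OF i x] by simp
    then obtain \<alpha> where \<alpha>: "\<phi> x < \<alpha>" "\<alpha> < \<delta> i" using dense by blast
    have sub: "T i \<subseteq> D" using i D(3) by auto
    have ni: "interior (T i) \<noteq> {}"
      using negligible_convex_interior[of "T i"] T[OF i] meas(1)[OF i] by (auto dest: negligible_imp_measure0)
    hence cl: "T i = closure (interior (T i))"
      using T[OF i] by (simp add: convex_closure_interior compact_imp_closed)
    obtain V where V: "open V" "V \<inter> D = D \<inter> \<phi> -` {..<\<alpha>}"
      using cont unfolding continuous_on_open_invariant
      by (metis Int_commute open_lessThan)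
    \<comment> \<open>A nonempty open part of the tile on which \<open>\<phi>\<close> stays below \<open>\<alpha>\<close>.\<close>
    define W where "W = V \<inter> interior (T i)"
    have "x \<in> V \<inter> closure (interior (T i))" using V(2) x sub \<alpha> cl by auto
    hence "W \<noteq> {}" unfolding W_def using open_Int_closure_eq_empty[OF V(1)] by blast
    moreover have "open W" unfolding W_def by (intro open_Int V(1) open_interior)
    ultimately have "\<not> negligible W" using open_not_negligible by blast
    have WT: "W \<subseteq> T i" unfolding W_def using interior_subset by auto
    have "W \<in> lmeasurable"
      by (rule lmeasurable_open) (use WT T[OF i] \<open>open W\<close> in \<open>auto intro: bounded_subset compact_imp_bounded\<close>)
    hence Wpos: "measure lebesgue W > 0"
      using \<open>\<not> negligible W\<close> by (simp add: negligible_iff_measure0 less_le)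
    \<comment> \<open>At level \<open>\<alpha>\<close>, the tiles of the first kind are disjoint from those of the second.\<close>
    define E where "E j = (if \<delta> j \<le> \<alpha> then T j else T' j)" for j
    have Em: "E j \<in> lmeasurable" if "j \<in> I" for j
      using T[OF that] T'[OF that] by (auto simp: E_def lmeasurable_compact)
    have mD: "measure lebesgue D = (\<Sum>j\<in>I. measure lebesgue (T j))"
      unfolding D(3) by (rule measure_negligible_finite_Union_image[OF fin])
        (use T tiling(1) in \<open>auto simp: lmeasurable_compact pairwise_def\<close>)
    have disj: "negligible (E j \<inter> E k)" if "j \<in> I" "k \<in> I" "j \<noteq> k" for j k
    proof -
      have "T j \<inter> T' k = {}" if "\<delta> j \<le> \<alpha>" "\<not> \<delta> k \<le> \<alpha>" "j \<in> I" "k \<in> I" for j k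
        using le[OF \<open>j \<in> I\<close>] ge[OF \<open>k \<in> I\<close>] that by fastforce
      thus ?thesis using tiling that unfolding E_def by (auto simp: Int_commute)
    qed
    have "measure lebesgue (\<Union>(E ` I)) = (\<Sum>j\<in>I. measure lebesgue (E j))"
      by (rule measure_negligible_finite_Union_image[OF fin]) (use Em disj in \<open>auto simp: pairwise_def\<close>)
    also have "\<dots> = measure lebesgue D"
      unfolding mD by (rule sum.cong) (auto simp: E_def meas(2))
    finally have mE: "measure lebesgue (\<Union>(E ` I)) = measure lebesgue D" .
    have UEm: "\<Union>(E ` I) \<in> lmeasurable" using fin Em by (intro fmeasurable.finite_UN) auto
    have "negligible (W \<inter> E j)" if j: "j \<in> I" for j
    proof (cases "\<delta> j \<le> \<alpha>")
      case True
      hence "j \<noteq> i" using \<alpha>(2) by auto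
      thus ?thesis using tiling(1)[OF i j] WT True unfolding E_def
        by (auto intro: negligible_subset)
    next
      case False
      have "W \<inter> T' j = {}"
      proof -
        have "\<phi> y < \<alpha>" if "y \<in> W" for y
          using that V(2) WT sub unfolding W_def by blast
        thus ?thesis using ge[OF j] False by fastforce
      qed
      thus ?thesis using False by (simp add: E_def)
    qed
    hence "negligible (W \<inter> \<Union>(E ` I))"
      unfolding Int_UN_distrib using fin by (intro negligible_Union) auto
    hence "measure lebesgue (W \<union> \<Union>(E ` I)) = measure lebesgue W + measure lebesgue D"
      using measure_Un3_negligible[of W "\<Union>(E ` I)" "{}"] \<open>W \<in> lmeasurable\<close> UEm mE by simp
    moreover have "measure lebesgue (W \<union> \<Union>(E ` I)) \<le> measure lebesgue D"
    proof (rule measure_mono_fmeasurable)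
      have "E j \<subseteq> D" if "j \<in> I" for j
      proof -
        have "T j \<subseteq> D" using D(3) that by blast
        thus ?thesis using T'[OF that] by (simp add: E_def)
      qed
      thus "W \<union> \<Union>(E ` I) \<subseteq> D" using WT sub by blast
      show "W \<union> \<Union>(E ` I) \<in> sets lebesgue" using \<open>W \<in> lmeasurable\<close> UEm by blast
      show "D \<in> lmeasurable" by (rule lmeasurable_compact[OF D(2)])
    qed
    ultimately show False using Wpos by simp
  qed
  have "finite (\<phi> ` D)"
    by (rule finite_subset[of _ "\<delta> ` I"]) (use eq D(3) fin in auto)
  then obtain c where c: "\<And>x. x \<in> D \<Longrightarrow> \<phi> x = c"
    using continuous_finite_range_constant[OF convex_connected[OF D(1)] cont] unfolding constant_on_def by blast
  have "\<delta> i = c" if i: "i \<in> I" for i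
  proof -
    have "T i \<noteq> {}" using meas(1)[OF i] by auto
    thus ?thesis using eq[OF i] c i D(3) by fastforce
  qed
  thus ?thesis using that by blast
qed

section \<open>Rigidity under a reflection\<close>

text \<open>
  Over a point \<open>z\<close> of the projection, the constraint of \<open>w\<close> bounds the height along \<open>u\<close> by
  \<open>(h w - w \<bullet> \<iota> z) / (u \<bullet> w)\<close> from above if \<open>u \<bullet> w > 0\<close>, and from below if \<open>u \<bullet> w < 0\<close>. The
  point at the smallest upper bound still belongs to \<open>P\<close>, because raising a point only relaxes
  the other constraints.
\<close>
lemma projection_of_upper_face:
  fixes \<iota> :: "real^3 \<Rightarrow> real^4"
  assumes \<iota>: "linear \<iota>" "\<And>x. norm (\<iota> x) = norm x" "range \<iota> = {y. u \<bullet> y = 0}" "norm u = 1"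
    and P: "P = {y. \<forall>v\<in>X. v \<bullet> y \<le> h v}"
    and v: "v \<in> X" "u \<bullet> v > 0"
  shows "adjoint \<iota> ` {y \<in> P. v \<bullet> y = h v} = {z \<in> adjoint \<iota> ` P.
      \<forall>w\<in>X. u \<bullet> w > 0 \<longrightarrow> (h v - v \<bullet> \<iota> z) / (u \<bullet> v) \<le> (h w - w \<bullet> \<iota> z) / (u \<bullet> w)}"
    (is "?l = ?r")
proof (intro equalityI subsetI)
  note \<pi> = adjoint_hyperplane_coordinates[OF \<iota>]
  fix z assume "z \<in> ?l"
  then obtain y where y: "y \<in> P" "v \<bullet> y = h v" "z = adjoint \<iota> y" by auto
  have yz: "y = \<iota> z + (u \<bullet> y) *\<^sub>R u" unfolding y(3) \<pi>(1) by simp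
  have *: "w \<bullet> y = w \<bullet> \<iota> z + (u \<bullet> y) * (u \<bullet> w)" for w
    by (subst yz) (simp add: inner_add_right inner_commute)
  have "(h v - v \<bullet> \<iota> z) / (u \<bullet> v) = u \<bullet> y" using *[of v] y(2) v(2) by (simp add: field_simps)
  moreover have "u \<bullet> y \<le> (h w - w \<bullet> \<iota> z) / (u \<bullet> w)" if "w \<in> X" "u \<bullet> w > 0" for w
  proof -
    have "w \<bullet> y \<le> h w" using y(1) that P by auto
    thus ?thesis using *[of w] that by (simp add: field_simps)
  qed
  ultimately show "z \<in> ?r" using y by auto
next
  note \<pi> = adjoint_hyperplane_coordinates[OF \<iota>]
  have lin: "linear (adjoint \<iota>)" by (rule adjoint_linear[OF \<iota>(1)])
  fix z assume z: "z \<in> ?r"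
  then obtain y where y: "y \<in> P" "z = adjoint \<iota> y" by auto
  have yz: "y = \<iota> z + (u \<bullet> y) *\<^sub>R u" unfolding y(2) \<pi>(1) by simp
  have *: "w \<bullet> y = w \<bullet> \<iota> z + (u \<bullet> y) * (u \<bullet> w)" for w
    by (subst yz) (simp add: inner_add_right inner_commute)
  define s where "s = (h v - v \<bullet> \<iota> z) / (u \<bullet> v)"
  define x where "x = \<iota> z + s *\<^sub>R u"
  have x: "w \<bullet> x = w \<bullet> \<iota> z + s * (u \<bullet> w)" for w
    by (simp add: x_def inner_add_right inner_commute)
  have s: "s \<le> (h w - w \<bullet> \<iota> z) / (u \<bullet> w)" if "w \<in> X" "u \<bullet> w > 0" for w
    using z that unfolding s_def by auto
  have "u \<bullet> y \<le> s"
  proof -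
    have "v \<bullet> y \<le> h v" using y(1) v(1) P by auto
    thus ?thesis using *[of v] v(2) unfolding s_def by (simp add: field_simps)
  qed
  have "w \<bullet> x \<le> h w" if w: "w \<in> X" for w
  proof (cases "u \<bullet> w > 0")
    case True
    thus ?thesis using s[OF w True] unfolding x by (simp add: field_simps)
  next
    case False
    hence "s * (u \<bullet> w) \<le> (u \<bullet> y) * (u \<bullet> w)" using \<open>u \<bullet> y \<le> s\<close> by (intro mult_right_mono_neg) auto
    moreover have "w \<bullet> y \<le> h w" using y(1) w P by auto
    ultimately show ?thesis using * x by (metis add_left_mono order_trans)
  qed
  hence "x \<in> P" using P by auto
  moreover have "v \<bullet> x = h v" using v(2) unfolding x s_def by simp
  moreover have "adjoint \<iota> x = z"
    unfolding x_def by (simp add: linear_add[OF lin] linear_scale[OF lin] \<pi>)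
  ultimately show "z \<in> ?l" by auto
qed

text \<open>
  Distinct upper facets project onto tiles that overlap in a null set: scaled to the same
  component along \<open>u\<close>, their normals differ by a nonzero vector orthogonal to \<open>u\<close>, and the
  heights of the two facet hyperplanes agree only on a hyperplane of the projection.
\<close>
lemma negligible_affine_coincidence:
  fixes \<iota> :: "real^3 \<Rightarrow> real^4"
  assumes \<iota>: "linear \<iota>" "\<And>x. norm (\<iota> x) = norm x" "range \<iota> = {y. u \<bullet> y = 0}" "norm u = 1"
    and v: "norm v = 1" "u \<bullet> v > 0" and w: "norm w = 1" "u \<bullet> w > 0" and "v \<noteq> w"
  shows "negligible {z. (a - v \<bullet> \<iota> z) / (u \<bullet> v) = (b - w \<bullet> \<iota> z) / (u \<bullet> w)}"
proof -
  define d where "d = v /\<^sub>R (u \<bullet> v) - w /\<^sub>R (u \<bullet> w)"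
  have "d \<noteq> 0"
  proof
    assume "d = 0"
    hence e: "v /\<^sub>R (u \<bullet> v) = w /\<^sub>R (u \<bullet> w)" by (simp add: d_def)
    hence "norm (v /\<^sub>R (u \<bullet> v)) = norm (w /\<^sub>R (u \<bullet> w))" by simp
    hence "u \<bullet> v = u \<bullet> w" using v w by simp
    thus False using e v \<open>v \<noteq> w\<close> by simp
  qed
  have "u \<bullet> d = 0" using v w by (simp add: d_def inner_diff_right)
  hence "\<iota> (adjoint \<iota> d) = d" using adjoint_hyperplane_coordinates(1)[OF \<iota>] by simp
  hence nz: "adjoint \<iota> d \<noteq> 0" using \<open>d \<noteq> 0\<close> linear_0[OF \<iota>(1)] by auto
  have "{z. (a - v \<bullet> \<iota> z) / (u \<bullet> v) = (b - w \<bullet> \<iota> z) / (u \<bullet> w)}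
     \<subseteq> {z. adjoint \<iota> d \<bullet> z = a / (u \<bullet> v) - b / (u \<bullet> w)}"
  proof
    fix z assume "z \<in> {z. (a - v \<bullet> \<iota> z) / (u \<bullet> v) = (b - w \<bullet> \<iota> z) / (u \<bullet> w)}"
    hence "d \<bullet> \<iota> z = a / (u \<bullet> v) - b / (u \<bullet> w)"
      using v(2) w(2) by (simp add: d_def inner_diff_left field_simps)
    thus "z \<in> {z. adjoint \<iota> d \<bullet> z = a / (u \<bullet> v) - b / (u \<bullet> w)}"
      using adjoint_works[OF \<iota>(1), of z d] by (simp add: inner_commute)
  qed
  thus ?thesis using negligible_hyperplane nz negligible_subset by blast
qed

lemma continuous_on_Min_family:
  fixes f :: "'i \<Rightarrow> 'a::topological_space \<Rightarrow> real"
  assumes "finite I" "I \<noteq> {}" "\<And>i. i \<in> I \<Longrightarrow> continuous_on S (f i)"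
  shows "continuous_on S (\<lambda>x. Min ((\<lambda>i. f i x) ` I))"
  using assms
proof (induction rule: finite_ne_induct)
  case (insert i I)
  have "Min ((\<lambda>i. f i x) ` insert i I) = min (f i x) (Min ((\<lambda>i. f i x) ` I))" for x
    using insert by simp
  thus ?case using insert by (auto intro!: continuous_on_min)
qed simp

text \<open>
  If mirror facets have equal volumes, then the mirror image of \<open>P\<close> is a translate of \<open>P\<close> along
  \<open>u\<close>, here in terms of the constants \<open>h\<close>. The tiles for \<open>two_tilings_constant\<close> are the
  projections of the facets on the upper side and of their mirror facets, and
  \<open>\<phi>\<close> compares the heights of the graphs above and below the mirror.
\<close>
lemma reflection_rigidity:
  fixes P :: "(real^4) set"
  assumes X: "finite X" "\<And>v. v \<in> X \<Longrightarrow> norm v = 1"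
    and u: "norm u = 1" "\<And>v. v \<in> X \<Longrightarrow> reflect u v \<in> X"
    and P: "P = {y. \<forall>v\<in>X. v \<bullet> y \<le> h v}" "compact P"
    and vol: "\<And>v. v \<in> X \<Longrightarrow> volume3 {y \<in> P. v \<bullet> y = h v} > 0"
      "\<And>v. v \<in> X \<Longrightarrow> volume3 {y \<in> P. reflect u v \<bullet> y = h (reflect u v)} = volume3 {y \<in> P. v \<bullet> y = h v}"
  obtains c where "\<And>v. v \<in> X \<Longrightarrow> h (reflect u v) = h v + c * (u \<bullet> v)"
proof -
  obtain \<iota> :: "real^3 \<Rightarrow> real^4"
    where \<iota>0: "linear \<iota>" "\<And>x. norm (\<iota> x) = norm x" "range \<iota> = {y. u \<bullet> y = 0}"
    using hyperplane_coordinates[OF u(1)] by blast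
  note \<iota> = \<iota>0 u(1)
  \<comment> \<open>The lower side is the upper side for the direction \<open>- u\<close>, with the same coordinates.\<close>
  have \<iota>': "range \<iota> = {y. (- u) \<bullet> y = 0}" "norm (- u) = 1" using \<iota> by auto
  define \<pi> where "\<pi> = adjoint \<iota>"
  have lin: "linear \<pi>" unfolding \<pi>_def by (rule adjoint_linear[OF \<iota>(1)])
  have cont\<iota>: "continuous_on S \<iota>" for S using \<iota>(1) by (simp add: linear_continuous_on linear_conv_bounded_linear)
  have cont\<pi>: "continuous_on S \<pi>" for S using lin by (simp add: linear_continuous_on linear_conv_bounded_linear)
  define Up where "Up = {v \<in> X. u \<bullet> v > 0}"
  have finUp: "finite Up" using X(1) by (simp add: Up_def)
  let ?\<rho> = "reflect u"
  \<comment> \<open>Heights of the facet hyperplanes over \<open>z\<close>: \<open>a\<close> upwards on the upper side, \<open>b\<close> downwards on the lower side.\<close>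
  define a where "a v z = (h v - v \<bullet> \<iota> z) / (u \<bullet> v)" for v z
  define b where "b v z = (h (?\<rho> v) - v \<bullet> \<iota> z) / (u \<bullet> v)" for v z
  define \<delta> where "\<delta> v = (h (?\<rho> v) - h v) / (u \<bullet> v)" for v
  have ba: "b v z - a v z = \<delta> v" for v z by (simp add: a_def b_def \<delta>_def diff_divide_distrib)
  have perp: "u \<bullet> \<iota> z = 0" for z using \<iota>(3) by auto
  have \<rho>\<iota>: "?\<rho> v \<bullet> \<iota> z = v \<bullet> \<iota> z" for v z
    by (simp add: reflect_inner_right) (simp add: reflect_def perp)
  define F where "F v = {y \<in> P. v \<bullet> y = h v}" for v
  define D where "D = \<pi> ` P"
  have convP: "convex P" unfolding P(1)
  proof -
    have "{y. \<forall>v\<in>X. v \<bullet> y \<le> h v} = (\<Inter>v\<in>X. {y. v \<bullet> y \<le> h v})" by auto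
    thus "convex {y. \<forall>v\<in>X. v \<bullet> y \<le> h v}" by (simp add: convex_INT convex_halfspace_le)
  qed
  have F: "compact (F v)" "convex (F v)" for v
  proof -
    have "F v = P \<inter> {y. v \<bullet> y = h v}" by (auto simp: F_def)
    thus "compact (F v)" "convex (F v)"
      by (auto intro!: compact_Int_closed convex_Int P(2) convP closed_hyperplane convex_hyperplane)
  qed
  have \<pi>F: "compact (\<pi> ` F v)" "convex (\<pi> ` F v)" for v
    using F[of v] by (auto intro: compact_continuous_image cont\<pi> convex_linear_image lin)
  have D: "compact D" "convex D" unfolding D_def
    using P(2) convP by (auto intro: compact_continuous_image cont\<pi> convex_linear_image lin)
  have T: "\<pi> ` F v = {z \<in> D. \<forall>w\<in>Up. a v z \<le> a w z}" if "v \<in> Up" for v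
    unfolding F_def D_def \<pi>_def a_def
    by (subst projection_of_upper_face[OF \<iota> P(1)]) (use that in \<open>auto simp: Up_def\<close>)
  have T': "\<pi> ` F (?\<rho> v) = {z \<in> D. \<forall>w\<in>Up. b v z \<le> b w z}" if v: "v \<in> Up" for v
  proof -
    have "?\<rho> v \<in> X" "- u \<bullet> ?\<rho> v > 0" using v u by (auto simp: Up_def inner_reflect)
    note pf = projection_of_upper_face[OF \<iota>(1,2) \<iota>' P(1) this]
    have "(\<forall>w\<in>X. - u \<bullet> w > 0 \<longrightarrow> b v z \<le> (h w - w \<bullet> \<iota> z) / (- u \<bullet> w)) \<longleftrightarrow> (\<forall>w\<in>Up. b v z \<le> b w z)" for z
    proof safe
      fix w assume "\<forall>w\<in>X. - u \<bullet> w > 0 \<longrightarrow> b v z \<le> (h w - w \<bullet> \<iota> z) / (- u \<bullet> w)" "w \<in> Up"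
      moreover have "?\<rho> w \<in> X" "- u \<bullet> ?\<rho> w > 0" using \<open>w \<in> Up\<close> u by (auto simp: Up_def inner_reflect)
      ultimately have "b v z \<le> (h (?\<rho> w) - ?\<rho> w \<bullet> \<iota> z) / (- u \<bullet> ?\<rho> w)" by blast
      thus "b v z \<le> b w z" by (simp add: b_def \<rho>\<iota> inner_reflect[OF u(1)])
    next
      fix w assume w: "\<forall>w\<in>Up. b v z \<le> b w z" "w \<in> X" "- u \<bullet> w > 0"
      hence "?\<rho> w \<in> Up" using u by (auto simp: Up_def inner_reflect)
      hence "b v z \<le> b (?\<rho> w) z" using w by blast
      thus "b v z \<le> (h w - w \<bullet> \<iota> z) / (- u \<bullet> w)"
        by (simp add: b_def \<rho>\<iota> inner_reflect[OF u(1)] reflect_reflect[OF u(1)])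
    qed
    moreover have "(h (?\<rho> v) - ?\<rho> v \<bullet> \<iota> z) / (- u \<bullet> ?\<rho> v) = b v z" for z
      by (simp add: b_def \<rho>\<iota> inner_reflect[OF u(1)])
    ultimately show ?thesis using pf unfolding F_def D_def \<pi>_def by simp
  qed
  have meas: "measure lebesgue (\<pi> ` F v) = \<bar>u \<bullet> v\<bar> * volume3 (F v)" if "v \<in> X" for v
    unfolding \<pi>_def
    by (rule measure_projection_facet[OF \<iota>, where b = "h v"])
       (use F[of v] X(2)[OF that] vol(1)[OF that] in \<open>auto simp: F_def\<close>)
  define \<phi> where "\<phi> z = Min ((\<lambda>v. b v z) ` Up) - Min ((\<lambda>v. a v z) ` Up)" for z
  have c: "\<exists>c. \<forall>v\<in>Up. \<delta> v = c"
  proof (cases "Up = {}")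
    case False
    have cont: "continuous_on D \<phi>" unfolding \<phi>_def a_def b_def
      by (intro continuous_intros continuous_on_Min_family finUp False cont\<iota>) (auto simp: Up_def)
    have DU: "D = \<Union>((\<lambda>v. \<pi> ` F v) ` Up)"
    proof (intro equalityI subsetI)
      fix z assume z: "z \<in> D"
      have "Min ((\<lambda>v. a v z) ` Up) \<in> (\<lambda>v. a v z) ` Up" using finUp False by (intro Min_in) auto
      then obtain v where v: "v \<in> Up" "Min ((\<lambda>v. a v z) ` Up) = a v z" by auto
      hence "\<forall>w\<in>Up. a v z \<le> a w z" using finUp by (auto simp flip: v(2))
      hence "z \<in> \<pi> ` F v" using T[OF v(1)] z by auto
      thus "z \<in> \<Union>((\<lambda>v. \<pi> ` F v) ` Up)" using v(1) by auto
    qed (use T in auto)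
    have mina: "Min ((\<lambda>v. a v z) ` Up) = a v z" if "v \<in> Up" "z \<in> \<pi> ` F v" for v z
      using that T[OF that(1)] finUp by (intro Min_eqI) auto
    have minb: "Min ((\<lambda>v. b v z) ` Up) = b v z" if "v \<in> Up" "z \<in> \<pi> ` F (?\<rho> v)" for v z
      using that T'[OF that(1)] finUp by (intro Min_eqI) auto
    have UpX: "v \<in> X" "u \<bullet> v > 0" "norm v = 1" "?\<rho> v \<in> X" if "v \<in> Up" for v
      using that X(2) u(2) by (auto simp: Up_def)
    show ?thesis
    proof (rule two_tilings_constant[OF finUp D(2,1) DU cont, where T' = "\<lambda>v. \<pi> ` F (?\<rho> v)" and \<delta> = \<delta>])
      fix v w assume vw: "v \<in> Up" "w \<in> Up" "v \<noteq> w"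
      show "negligible (\<pi> ` F v \<inter> \<pi> ` F w)"
      proof (rule negligible_subset)
        show "negligible {z. (h v - v \<bullet> \<iota> z) / (u \<bullet> v) = (h w - w \<bullet> \<iota> z) / (u \<bullet> w)}"
          using vw UpX by (intro negligible_affine_coincidence[OF \<iota>]) auto
        show "\<pi> ` F v \<inter> \<pi> ` F w \<subseteq> {z. (h v - v \<bullet> \<iota> z) / (u \<bullet> v) = (h w - w \<bullet> \<iota> z) / (u \<bullet> w)}"
          using mina[OF vw(1)] mina[OF vw(2)] unfolding a_def by fastforce
      qed
      show "negligible (\<pi> ` F (?\<rho> v) \<inter> \<pi> ` F (?\<rho> w))"
      proof (rule negligible_subset)
        show "negligible {z. (h (?\<rho> v) - v \<bullet> \<iota> z) / (u \<bullet> v) = (h (?\<rho> w) - w \<bullet> \<iota> z) / (u \<bullet> w)}"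
          using vw UpX by (intro negligible_affine_coincidence[OF \<iota>]) auto
        show "\<pi> ` F (?\<rho> v) \<inter> \<pi> ` F (?\<rho> w)
            \<subseteq> {z. (h (?\<rho> v) - v \<bullet> \<iota> z) / (u \<bullet> v) = (h (?\<rho> w) - w \<bullet> \<iota> z) / (u \<bullet> w)}"
          using minb[OF vw(1)] minb[OF vw(2)] unfolding b_def by fastforce
      qed
    next
      fix v assume v: "v \<in> Up"
      show "compact (\<pi> ` F v) \<and> convex (\<pi> ` F v)" using \<pi>F by blast
      show "compact (\<pi> ` F (?\<rho> v)) \<and> \<pi> ` F (?\<rho> v) \<subseteq> D" using \<pi>F(1)[of "?\<rho> v"] unfolding T'[OF v] by blast
      show "measure lebesgue (\<pi> ` F v) > 0"
        using UpX[OF v] vol(1)[of v, folded F_def] by (simp add: meas)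
      show "measure lebesgue (\<pi> ` F (?\<rho> v)) = measure lebesgue (\<pi> ` F v)"
        using UpX[OF v] vol(2)[of v, folded F_def] by (simp add: meas inner_reflect[OF u(1)])
    next
      fix v z assume v: "v \<in> Up" and z: "z \<in> \<pi> ` F v"
      have "Min ((\<lambda>v. b v z) ` Up) \<le> b v z" using finUp v by auto
      thus "\<phi> z \<le> \<delta> v" unfolding \<phi>_def mina[OF v z] ba[of v z, symmetric] by simp
    next
      fix v z assume v: "v \<in> Up" and z: "z \<in> \<pi> ` F (?\<rho> v)"
      have "Min ((\<lambda>v. a v z) ` Up) \<le> a v z" using finUp v by auto
      thus "\<delta> v \<le> \<phi> z" unfolding \<phi>_def minb[OF v z] ba[of v z, symmetric] by simp
    qed blast
  qed simp
  then obtain c where c: "\<And>v. v \<in> Up \<Longrightarrow> \<delta> v = c" by blast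
  have up: "h (?\<rho> v) = h v + c * (u \<bullet> v)" if "v \<in> X" "u \<bullet> v > 0" for v
    using c[of v] that by (simp add: Up_def \<delta>_def field_simps)
  show ?thesis
  proof (rule that[of c])
    fix v assume v: "v \<in> X"
    consider "u \<bullet> v > 0" | "u \<bullet> v = 0" | "u \<bullet> v < 0" by linarith
    thus "h (?\<rho> v) = h v + c * (u \<bullet> v)"
    proof cases
      case 2 thus ?thesis by (simp add: reflect_def)
    next
      case 3
      thus ?thesis using up[of "?\<rho> v"] u v by (simp add: inner_reflect reflect_reflect)
    qed (use up v in auto)
  qed
qed

section \<open>Support functions and the Steiner point\<close>

lemma inner_le_support_fun:
  assumes "compact P" "y \<in> P"
  shows "u \<bullet> y \<le> support_fun P u"
  unfolding support_fun_def
proof (rule cSUP_upper[OF assms(2)])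
  have "compact ((\<bullet>) u ` P)" by (intro compact_continuous_image continuous_intros assms(1))
  thus "bdd_above ((\<bullet>) u ` P)" by (intro bounded_imp_bdd_above compact_imp_bounded)
qed

lemma support_fun_le:
  assumes "P \<noteq> {}" "\<And>y. y \<in> P \<Longrightarrow> u \<bullet> y \<le> b"
  shows "support_fun P u \<le> b"
  unfolding support_fun_def using assms by (rule cSUP_least)

lemma facet_imp_outer_unit_normal:
  assumes "compact P" and F: "F facet_of P" and ab: "a \<noteq> 0" "P \<subseteq> {x. a \<bullet> x \<le> b}" "F = P \<inter> {x. a \<bullet> x = b}"
  shows "outer_unit_normal P F (a /\<^sub>R norm a)" "support_fun P (a /\<^sub>R norm a) = b / norm a"
proof -
  obtain y where y: "y \<in> P" "a \<bullet> y = b" using F ab(3) by (auto simp: facet_of_def)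
  have pos: "norm a > 0" using ab(1) by simp
  show s: "support_fun P (a /\<^sub>R norm a) = b / norm a"
  proof (rule antisym)
    show "support_fun P (a /\<^sub>R norm a) \<le> b / norm a"
      by (rule support_fun_le) (use y ab(2) pos in \<open>auto simp: field_simps\<close>)
    show "b / norm a \<le> support_fun P (a /\<^sub>R norm a)"
      using inner_le_support_fun[OF assms(1) y(1), of "a /\<^sub>R norm a"] y(2) by (simp add: field_simps)
  qed
  show "outer_unit_normal P F (a /\<^sub>R norm a)"
    unfolding outer_unit_normal_def s ab(3) using pos by (auto simp: field_simps)
qed

text \<open>
  Each half-space of an irredundant description of \<open>P\<close> carries a facet, so its unit normal lies
  in \<open>X\<close> and its bound is the value of the support function.
\<close>
lemma minkowski_polytope_structure:
  assumes "minkowski_polytope X P"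
  shows "compact P" "P \<noteq> {}" "P = {y. \<forall>v\<in>X. v \<bullet> y \<le> support_fun P v}"
    and "\<And>v. v \<in> X \<Longrightarrow> norm v = 1"
    and "\<And>v. v \<in> X \<Longrightarrow> volume3 {y \<in> P. v \<bullet> y = support_fun P v} = 2 * pi^2 / card X"
    and "\<And>F. F facet_of P \<Longrightarrow> \<exists>v\<in>X. F = {y \<in> P. v \<bullet> y = support_fun P v}"
proof -
  have poly: "polytope P" and dim: "aff_dim P = 4"
    and X: "{u. \<exists>F. F facet_of P \<and> outer_unit_normal P F u} = X"
    and vol: "\<And>F. F facet_of P \<Longrightarrow> volume3 F = 2 * pi^2 / card X"
    using assms unfolding minkowski_polytope_def by auto
  show comp: "compact P" using poly by (rule polytope_imp_compact)
  show ne: "P \<noteq> {}" using dim by auto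
  show "norm v = 1" if "v \<in> X" for v using that X by (auto simp: outer_unit_normal_def)
  show "volume3 {y \<in> P. v \<bullet> y = support_fun P v} = 2 * pi^2 / card X" if "v \<in> X" for v
    using that X vol by (auto simp: outer_unit_normal_def)
  have ph: "polyhedron P" using poly by (rule polytope_imp_polyhedron)
  show "\<exists>v\<in>X. F = {y \<in> P. v \<bullet> y = support_fun P v}" if F: "F facet_of P" for F
  proof -
    obtain a b where ab: "a \<noteq> 0" "P \<subseteq> {x. a \<bullet> x \<le> b}" "F = P \<inter> {x. a \<bullet> x = b}"
      using facet_of_polyhedron[OF ph F] by blast
    have "outer_unit_normal P F (a /\<^sub>R norm a)" by (rule facet_imp_outer_unit_normal[OF comp F ab])
    thus ?thesis using X F unfolding outer_unit_normal_def by blast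
  qed
  have hull: "affine hull P = UNIV" using dim aff_dim_eq_full[of P] by simp
  obtain H where H: "finite H" "P = affine hull P \<inter> \<Inter>H"
      "\<forall>h\<in>H. \<exists>a b. a \<noteq> 0 \<and> h = {x. a \<bullet> x \<le> b}"
      "\<And>H'. H' \<subset> H \<Longrightarrow> P \<subset> affine hull P \<inter> \<Inter>H'"
    using ph unfolding polyhedron_Int_affine_minimal by blast
  then obtain a b where ab: "\<And>h. h \<in> H \<Longrightarrow> a h \<noteq> 0 \<and> h = {x. a h \<bullet> x \<le> b h}" by metis
  show "P = {y. \<forall>v\<in>X. v \<bullet> y \<le> support_fun P v}"
  proof (intro equalityI subsetI)
    fix y assume "y \<in> P"
    thus "y \<in> {y. \<forall>v\<in>X. v \<bullet> y \<le> support_fun P v}" using inner_le_support_fun[OF comp] by blast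
  next
    fix y assume y: "y \<in> {y. \<forall>v\<in>X. v \<bullet> y \<le> support_fun P v}"
    have "y \<in> h" if h: "h \<in> H" for h
    proof -
      let ?F = "P \<inter> {x. a h \<bullet> x = b h}"
      have F: "?F facet_of P"
        using facet_of_polyhedron_explicit[OF H(1,2) ab H(4), of ?F] h by blast
      have sub: "P \<subseteq> {x. a h \<bullet> x \<le> b h}" using H(2) ab[OF h] h by blast
      have nz: "a h \<noteq> 0" using ab[OF h] by blast
      note n = facet_imp_outer_unit_normal[OF comp F nz sub refl]
      have "a h /\<^sub>R norm (a h) \<in> X" using X F n(1) by blast
      hence "(a h /\<^sub>R norm (a h)) \<bullet> y \<le> b h / norm (a h)" using y n(2) by force
      hence "a h \<bullet> y \<le> b h" using nz by (simp add: field_simps)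
      thus "y \<in> h" using ab[OF h] by blast
    qed
    thus "y \<in> P" using H(2) hull by blast
  qed
qed

lemma support_fun_Lipschitz:
  assumes "compact P" "P \<noteq> {}" "\<And>y. y \<in> P \<Longrightarrow> norm y \<le> B"
  shows "\<bar>support_fun P u - support_fun P w\<bar> \<le> B * norm (u - w)"
proof -
  have "support_fun P u \<le> support_fun P w + B * norm (u - w)" for u w
  proof (rule support_fun_le[OF assms(2)])
    fix y assume y: "y \<in> P"
    have "u \<bullet> y = w \<bullet> y + (u - w) \<bullet> y" by (simp add: inner_diff_left)
    also have "w \<bullet> y \<le> support_fun P w" by (rule inner_le_support_fun[OF assms(1) y])
    also have "(u - w) \<bullet> y \<le> norm (u - w) * norm y" by (rule norm_cauchy_schwarz)
    also have "norm (u - w) * norm y \<le> norm (u - w) * B" by (intro mult_left_mono assms(3) y) simp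
    finally show "u \<bullet> y \<le> support_fun P w + B * norm (u - w)" by (simp add: mult.commute)
  qed
  from this[of u w] this[of w u] show ?thesis by (simp add: norm_minus_commute)
qed

lemma support_fun_0: "P \<noteq> {} \<Longrightarrow> support_fun P 0 = 0"
  by (simp add: support_fun_def)

text \<open>
  For an involution, preimages of boxes are images, to which the invariance of Lebesgue measure
  under orthogonal maps applies.
\<close>
lemma distr_lborel_orthogonal:
  fixes f :: "real^'n::{finite,wellorder} \<Rightarrow> real^'n::{finite,wellorder}"
  assumes f: "orthogonal_transformation f" and inv: "\<And>x. f (f x) = x"
  shows "distr lborel borel f = lborel"
proof (rule lborel_eqI[symmetric])
  have cont: "continuous_on UNIV f"
    using orthogonal_transformation_linear[OF f] by (simp add: linear_continuous_on linear_conv_bounded_linear)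
  hence m[measurable]: "f \<in> borel_measurable borel" by (rule borel_measurable_continuous_onI)
  fix l u :: "real^'n::{finite,wellorder}" assume le: "\<And>b. b \<in> Basis \<Longrightarrow> l \<bullet> b \<le> u \<bullet> b"
  have img: "f -` box l u = f ` box l u"
  proof (intro equalityI subsetI)
    fix x assume "x \<in> f -` box l u"
    thus "x \<in> f ` box l u" using image_eqI[of x f "f x" "box l u"] inv by simp
  qed (use inv in auto)
  have b: "f ` box l u \<in> sets borel"
    using measurable_sets[OF m, of "box l u"] by (simp add: img)
  have lm: "f ` box l u \<in> lmeasurable" "measure lebesgue (f ` box l u) = measure lebesgue (box l u)"
    by (rule measurable_orthogonal_image[OF f] measure_orthogonal_image[OF f]; simp)+
  have "emeasure (distr lborel borel f) (box l u) = emeasure lborel (f ` box l u)"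
    by (subst emeasure_distr) (auto simp: img)
  also have "\<dots> = emeasure lebesgue (f ` box l u)" using b by simp
  also have "\<dots> = emeasure lebesgue (box l u)"
    using emeasure_eq_measure2[OF lm(1)] lm(2) emeasure_eq_measure2[of "box l u" lebesgue] by simp
  also have "\<dots> = (\<Prod>b\<in>Basis. (u - l) \<bullet> b)"
    using le by (simp add: emeasure_lborel_box)
  finally show "emeasure (distr lborel borel f) (box l u) = (\<Prod>b\<in>Basis. (u - l) \<bullet> b)" .
qed simp

lemma reflect_orthogonal_transformation: "norm u = 1 \<Longrightarrow> orthogonal_transformation (reflect u)"
  by (simp add: orthogonal_transformation_def linear_reflect reflect_inner_reflect)

lemma sgn_measurable [measurable]: "(sgn :: 'a::euclidean_space \<Rightarrow> 'a) \<in> borel_measurable borel"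
  unfolding sgn_div_norm[abs_def] by measurable

lemma reflect_measurable [measurable]: "reflect u \<in> borel_measurable (borel :: (real^'n) measure)"
  unfolding reflect_def[abs_def] by measurable

lemma sphere_measure_reflect:
  assumes u: "norm u = 1"
  shows "distr sphere_measure borel (reflect u) = sphere_measure"
proof -
  let ?U = "uniform_measure lborel (ball 0 1 :: (real^4) set)"
  note ot = reflect_orthogonal_transformation[OF u]
  have nrm: "norm (reflect u x) = norm x" for x by (rule orthogonal_transformation_norm[OF ot])
  have U: "distr ?U borel (reflect u) = ?U"
  proof (rule measure_eqI)
    fix A assume "A \<in> sets (distr ?U borel (reflect u))"
    hence A[measurable]: "A \<in> sets borel" by simp
    have pre: "reflect u -` A \<in> sets borel"
      using measurable_sets[OF reflect_measurable[of u] A] by simp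
    have "emeasure (distr ?U borel (reflect u)) A
        = emeasure lborel (ball 0 1 \<inter> reflect u -` A) / emeasure lborel (ball 0 1 :: (real^4) set)"
      using pre by (simp add: emeasure_distr)
    also have "ball 0 1 \<inter> reflect u -` A = reflect u -` (ball 0 1 \<inter> A)"
      by (auto simp: nrm)
    also have "emeasure lborel (reflect u -` (ball 0 1 \<inter> A)) = emeasure (distr lborel borel (reflect u)) (ball 0 1 \<inter> A)"
      by (simp add: emeasure_distr)
    also have "distr lborel borel (reflect u) = lborel"
      by (rule distr_lborel_orthogonal[OF ot reflect_reflect[OF u]])
    finally show "emeasure (distr ?U borel (reflect u)) A = emeasure ?U A" by simp
  qed simp
  have "distr sphere_measure borel (reflect u) = distr ?U borel (reflect u \<circ> sgn)"
    unfolding sphere_measure_def by (rule distr_distr) measurable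
  also have "reflect u \<circ> sgn = sgn \<circ> reflect u"
    by (rule ext) (simp add: sgn_div_norm nrm linear_scale[OF linear_reflect])
  also have "distr ?U borel (sgn \<circ> reflect u) = distr (distr ?U borel (reflect u)) borel sgn"
    by (rule distr_distr[symmetric]) measurable
  finally show ?thesis unfolding U sphere_measure_def .
qed

lemma emeasure_unit_ball:
  "emeasure lborel (ball 0 1 :: 'a::euclidean_space set) \<noteq> 0"
  "emeasure lborel (ball 0 1 :: 'a::euclidean_space set) < \<infinity>"
proof -
  show "emeasure lborel (ball 0 1 :: 'a set) \<noteq> 0"
  proof
    assume "emeasure lborel (ball 0 1 :: 'a set) = 0"
    hence "ball 0 1 \<in> null_sets (lborel :: 'a measure)" by (simp add: null_sets_def)
    hence "negligible (ball 0 1 :: 'a set)"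
      unfolding negligible_iff_null_sets by (rule null_sets_completionI)
    thus False using open_not_negligible[of "ball 0 1 :: 'a set"] by simp
  qed
  show "emeasure lborel (ball 0 1 :: 'a set) < \<infinity>"
    by (rule emeasure_lborel_ball_finite)
qed

lemma sphere_measure_basics:
  shows "sets sphere_measure = sets borel" "space sphere_measure = UNIV"
    "finite_measure sphere_measure" "AE x in sphere_measure. norm x \<le> 1"
proof -
  show "sets sphere_measure = sets borel" "space sphere_measure = UNIV"
    by (simp_all add: sphere_measure_def)
  have "emeasure sphere_measure UNIV = 1"
    using emeasure_unit_ball[where 'a="real^4"]
    by (simp add: sphere_measure_def emeasure_distr ennreal_divide_self less_top)
  thus "finite_measure sphere_measure"
    by (intro finite_measureI) (simp add: sphere_measure_def)
  show "AE x in sphere_measure. norm x \<le> 1"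
    unfolding sphere_measure_def by (subst AE_distr_iff) (auto simp: norm_sgn)
qed

text \<open>
  A vanishing second moment would put almost all of the ball in the hyperplane orthogonal to
  \<open>u\<close>.
\<close>
lemma sphere_second_moment_pos:
  assumes u: "norm u = 1"
  shows "(\<integral>x. (u \<bullet> x)\<^sup>2 \<partial>sphere_measure) > 0"
proof -
  interpret finite_measure sphere_measure by (rule sphere_measure_basics)
  note [simp, measurable_cong] = sphere_measure_basics(1)
  have int: "integrable sphere_measure (\<lambda>x. (u \<bullet> x)\<^sup>2)"
  proof (rule integrable_const_bound[where B=1])
    show "AE x in sphere_measure. norm ((u \<bullet> x)\<^sup>2) \<le> 1"
      using sphere_measure_basics(4)
    proof eventually_elim
      case (elim x)
      have "\<bar>u \<bullet> x\<bar> \<le> 1" using Cauchy_Schwarz_ineq2[of u x] u elim by simp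
      thus ?case by (simp add: abs_square_le_1)
    qed
  qed measurable
  have "(\<integral>x. (u \<bullet> x)\<^sup>2 \<partial>sphere_measure) \<noteq> 0"
  proof
    assume "(\<integral>x. (u \<bullet> x)\<^sup>2 \<partial>sphere_measure) = 0"
    hence "AE x in sphere_measure. u \<bullet> x = 0"
      using integral_nonneg_eq_0_iff_AE[OF int] by simp
    hence "AE x in uniform_measure lborel (ball 0 1). u \<bullet> sgn x = 0"
      unfolding sphere_measure_def by (subst (asm) AE_distr_iff) auto
    hence "AE x in lborel. x \<in> ball 0 1 \<longrightarrow> u \<bullet> sgn x = 0"
      using AE_uniform_measure[OF emeasure_unit_ball, of "\<lambda>x. u \<bullet> sgn x = 0"] by simp
    hence "AE x in lborel. x \<in> ball 0 1 \<longrightarrow> u \<bullet> x = 0"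
      by eventually_elim (auto simp: sgn_div_norm)
    then obtain N where "N \<in> null_sets lborel" and N: "{x. \<not> (x \<in> ball 0 1 \<longrightarrow> u \<bullet> x = 0)} \<subseteq> N"
      unfolding eventually_ae_filter by auto
    hence "negligible N" unfolding negligible_iff_null_sets by (intro null_sets_completionI)
    hence "negligible {x. \<not> (x \<in> ball 0 1 \<longrightarrow> u \<bullet> x = 0)}"
      using N by (rule negligible_subset)
    moreover have "u \<noteq> 0" using u by auto
    hence "negligible {x. u \<bullet> x = 0}" by (intro negligible_hyperplane) auto
    ultimately have "negligible ({x. \<not> (x \<in> ball 0 1 \<longrightarrow> u \<bullet> x = 0)} \<union> {x. u \<bullet> x = 0})"
      by (rule negligible_Un)
    hence "negligible (ball 0 1 :: (real^4) set)" by (rule negligible_subset) auto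
    thus False using open_not_negligible[of "ball 0 1 :: (real^4) set"] by simp
  qed
  moreover have "(\<integral>x. (u \<bullet> x)\<^sup>2 \<partial>sphere_measure) \<ge> 0" by simp
  ultimately show ?thesis by linarith
qed

text \<open>
  Reflection invariance of the sphere measure turns the integral of \<open>h x * (u \<bullet> x)\<close>, which
  is proportional to the \<open>u\<close>-component of the Steiner point, into its negative minus \<open>c\<close> times the
  second moment in direction \<open>u\<close>. As the former is zero, so is \<open>c\<close>.
\<close>
lemma steiner_point_zero_no_drift:
  assumes P: "compact P" "P \<noteq> {}" and u: "norm u = 1"
    and drift: "\<And>x. support_fun P (reflect u x) = support_fun P x + c * (u \<bullet> x)"
    and steiner: "steiner_point P = 0"
  shows "c = 0"
proof -
  interpret finite_measure sphere_measure by (rule sphere_measure_basics)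
  note [simp, measurable_cong] = sphere_measure_basics(1)
  let ?h = "support_fun P" and ?\<sigma> = sphere_measure
  obtain B where B: "\<And>y. y \<in> P \<Longrightarrow> norm y \<le> B" "B \<ge> 0"
    using compact_imp_bounded[OF P(1)] by (metis bounded_iff norm_ge_zero order_trans linear)
  have lip: "\<bar>?h x - ?h w\<bar> \<le> B * norm (x - w)" for x w
    by (rule support_fun_Lipschitz[OF P B(1)])
  have "continuous_on UNIV ?h"
    by (rule lipschitz_on_continuous_on[of B]) (use B lip in \<open>auto simp: lipschitz_on_def dist_norm\<close>)
  hence [measurable]: "?h \<in> borel_measurable borel" by (rule borel_measurable_continuous_onI)
  have hb: "\<bar>?h x\<bar> \<le> B" if "norm x \<le> 1" for x
    using lip[of x 0] that B(2) support_fun_0[OF P(2)] mult_left_mono[OF that B(2)] by simp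
  have int1: "integrable ?\<sigma> (\<lambda>x. ?h x *\<^sub>R x)"
  proof (rule integrable_const_bound[where B="B"])
    show "AE x in ?\<sigma>. norm (?h x *\<^sub>R x) \<le> B"
      using sphere_measure_basics(4)
    proof eventually_elim
      case (elim x)
      show ?case using mult_mono[OF hb[OF elim] elim B(2)] by simp
    qed
  qed measurable
  have int2: "integrable ?\<sigma> (\<lambda>x. ?h x * (u \<bullet> x))"
    using integrable_inner_right[OF int1, of u] by (simp add: inner_commute)
  have int3: "integrable ?\<sigma> (\<lambda>x. (u \<bullet> x)\<^sup>2)"
    using sphere_second_moment_pos[OF u] not_integrable_integral_eq by fastforce
  have "(\<integral>x. ?h x *\<^sub>R x \<partial>?\<sigma>) = 0" using steiner by (simp add: steiner_point_def)
  hence T: "(\<integral>x. ?h x * (u \<bullet> x) \<partial>?\<sigma>) = 0"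
    using integral_inner_right[OF int1, of u] by simp
  have "0 = (\<integral>x. ?h x * (u \<bullet> x) \<partial>distr ?\<sigma> borel (reflect u))"
    unfolding sphere_measure_reflect[OF u] T ..
  also have "\<dots> = (\<integral>x. ?h (reflect u x) * (u \<bullet> reflect u x) \<partial>?\<sigma>)"
    by (rule integral_distr) measurable
  also have "\<dots> = (\<integral>x. - (?h x * (u \<bullet> x)) - c * (u \<bullet> x)\<^sup>2 \<partial>?\<sigma>)"
    by (intro Bochner_Integration.integral_cong refl)
       (simp add: drift inner_reflect[OF u] power2_eq_square algebra_simps)
  also have "\<dots> = - c * (\<integral>x. (u \<bullet> x)\<^sup>2 \<partial>?\<sigma>)"
    using int2 int3 T by simp
  finally show "c = 0" using sphere_second_moment_pos[OF u] by simp
qed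

text \<open>
  \<open>reflection_rigidity\<close> gives a constant \<open>c\<close> for the directions in \<open>X\<close>. Since these directions
  describe \<open>P\<close>, the same \<open>c\<close> serves for the support function in every direction, and the Steiner
  point forces \<open>c = 0\<close>.
\<close>
lemma minkowski_polytope_reflection_symmetric:
  assumes P: "minkowski_polytope X P" "steiner_point P = 0" and X: "finite X"
    and u: "norm u = 1" "\<And>v. v \<in> X \<Longrightarrow> reflect u v \<in> X" and v: "v \<in> X"
  shows "support_fun P (reflect u v) = support_fun P v"
proof -
  let ?h = "support_fun P"
  note S = minkowski_polytope_structure[OF P(1)]
  have pos: "2 * pi^2 / card X > 0"
  proof -
    have "card X > 0" using v X by (auto simp: card_gt_0_iff)
    thus ?thesis by simp
  qed
  obtain c where c: "\<And>v. v \<in> X \<Longrightarrow> ?h (reflect u v) = ?h v + c * (u \<bullet> v)"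
    by (rule reflection_rigidity[OF X S(4) u S(3,1)]) (use S(5) u(2) pos in auto)
  have le: "?h (reflect u x) \<le> ?h x + c * (u \<bullet> x)" for x
  proof (rule support_fun_le[OF S(2)])
    fix y assume y: "y \<in> P"
    \<comment> \<open>The reflected point, shifted back by the drift, satisfies every inequality that defines \<open>P\<close>.\<close>
    define z where "z = reflect u y - c *\<^sub>R u"
    have "v \<bullet> z \<le> ?h v" if "v \<in> X" for v
    proof -
      have "v \<bullet> z = reflect u v \<bullet> y - c * (u \<bullet> v)"
        by (simp add: z_def inner_diff_right reflect_inner_right inner_commute[of v u])
      also have "reflect u v \<bullet> y \<le> ?h (reflect u v)" by (rule inner_le_support_fun[OF S(1) y])
      finally show ?thesis using c[OF that] by simp
    qed
    hence "z \<in> P" by (subst S(3)) auto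
    have "reflect u x \<bullet> y = x \<bullet> z + c * (u \<bullet> x)"
      by (simp add: z_def inner_diff_right reflect_inner_right inner_commute[of x u])
    thus "reflect u x \<bullet> y \<le> ?h x + c * (u \<bullet> x)"
      using inner_le_support_fun[OF S(1) \<open>z \<in> P\<close>, of x] by simp
  qed
  have "?h (reflect u x) = ?h x + c * (u \<bullet> x)" for x
    using le[of x] le[of "reflect u x"] u(1) by (simp add: reflect_reflect inner_reflect)
  hence "c = 0" by (rule steiner_point_zero_no_drift[OF S(1,2) u(1) _ P(2)])
  thus ?thesis using c[OF v] by simp
qed

section \<open>The Gaussian rule of the semicircle density\<close>

text \<open>
  The integrand is the derivative of \<open>s ^ k * (1 - s\<^sup>2) powr (3/2)\<close>, which vanishes at both ends.
  This yields the recursion for the moments of the semicircle density.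
\<close>
lemma sqrt_moment_step:
  fixes k :: nat
  defines "f \<equiv> (\<lambda>s::real. s ^ k * (1 - s\<^sup>2) * sqrt (1 - s\<^sup>2))"
  shows "((\<lambda>s::real. (real k * s ^ (k - 1) * (1 - s\<^sup>2) - 3 * s ^ (k + 1)) * sqrt (1 - s\<^sup>2)) has_integral 0) {-1..1}"
proof -
  let ?f' = "\<lambda>s::real. (real k * s ^ (k - 1) * (1 - s\<^sup>2) - 3 * s ^ (k + 1)) * sqrt (1 - s\<^sup>2)"
  have "(?f' has_integral f 1 - f (-1)) {-1..1}"
  proof (rule fundamental_theorem_of_calculus_interior)
    show "continuous_on {-1..1} f" unfolding f_def by (intro continuous_intros)
    fix x :: real assume x: "x \<in> {-1<..<1}"
    hence pos: "1 - x\<^sup>2 > 0" using abs_square_less_1[of x] by auto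
    have w: "sqrt (1 - x\<^sup>2) * sqrt (1 - x\<^sup>2) = 1 - x\<^sup>2" using pos by simp
    have q: "(1 - x\<^sup>2) * inverse (sqrt (1 - x\<^sup>2)) = sqrt (1 - x\<^sup>2)"
      using pos w by (simp add: field_simps)
    have "(f has_real_derivative
        (real k * x ^ (k - 1) * (1 - x\<^sup>2) + x ^ k * (- 2 * x)) * sqrt (1 - x\<^sup>2)
        + x ^ k * (1 - x\<^sup>2) * (inverse (sqrt (1 - x\<^sup>2)) / 2 * (- 2 * x))) (at x)"
      unfolding f_def using pos
      by (auto intro!: derivative_eq_intros simp: algebra_simps)
    also have "(real k * x ^ (k - 1) * (1 - x\<^sup>2) + x ^ k * (- 2 * x)) * sqrt (1 - x\<^sup>2)
        + x ^ k * (1 - x\<^sup>2) * (inverse (sqrt (1 - x\<^sup>2)) / 2 * (- 2 * x))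
      = (real k * x ^ (k - 1) * (1 - x\<^sup>2) + x ^ k * (- 2 * x)) * sqrt (1 - x\<^sup>2)
        - x ^ (k+1) * ((1 - x\<^sup>2) * inverse (sqrt (1 - x\<^sup>2)))" by (simp add: algebra_simps)
    also have "\<dots> = ?f' x" unfolding q by (simp add: algebra_simps)
    finally show "(f has_vector_derivative ?f' x) (at x)"
      by (simp add: has_real_derivative_iff_has_vector_derivative)
  qed simp
  thus ?thesis by (simp add: f_def)
qed

definition half_disc_moment :: "nat \<Rightarrow> real" where
  "half_disc_moment k = integral {-1..1} (\<lambda>s. s ^ k * sqrt (1 - s\<^sup>2))"

lemma half_disc_moment_integrable: "(\<lambda>s::real. s ^ k * sqrt (1 - s\<^sup>2)) integrable_on {-1..1}"
  by (intro integrable_continuous_interval continuous_intros)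

lemma half_disc_moment_Suc:
  "half_disc_moment (k + 1) = real k / (real k + 3) * half_disc_moment (k - 1)"
proof -
  have e: "(real k * s ^ (k - 1) * (1 - s\<^sup>2) - 3 * s ^ (k + 1)) * sqrt (1 - s\<^sup>2)
     = real k * (s ^ (k - 1) * sqrt (1 - s\<^sup>2)) - (real k + 3) * (s ^ (k+1) * sqrt (1 - s\<^sup>2))" for s :: real
    by (cases k) (simp_all add: algebra_simps power2_eq_square)
  have "0 = integral {-1..1} (\<lambda>s::real. real k * (s ^ (k - 1) * sqrt (1 - s\<^sup>2))
           - (real k + 3) * (s ^ (k+1) * sqrt (1 - s\<^sup>2)))"
    using integral_unique[OF sqrt_moment_step[of k]] unfolding e by simp
  also have "\<dots> = integral {-1..1} (\<lambda>s::real. real k * (s ^ (k - 1) * sqrt (1 - s\<^sup>2)))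
           - integral {-1..1} (\<lambda>s::real. (real k + 3) * (s ^ (k+1) * sqrt (1 - s\<^sup>2)))"
    by (intro integral_diff integrable_on_mult_right half_disc_moment_integrable)
  also have "\<dots> = real k * half_disc_moment (k - 1) - (real k + 3) * half_disc_moment (k + 1)"
    by (simp add: half_disc_moment_def)
  finally show ?thesis by (simp add: field_simps)
qed

lemma half_disc_moment_0_pos: "half_disc_moment 0 > 0"
proof -
  have "half_disc_moment 0 \<noteq> 0"
  proof
    assume "half_disc_moment 0 = 0"
    hence "((\<lambda>s::real. sqrt (1 - s\<^sup>2)) has_integral 0) (cbox (-1) 1)"
      using half_disc_moment_integrable[of 0] by (simp add: half_disc_moment_def has_integral_integral)
    moreover have "continuous_on (cbox (-1) 1) (\<lambda>s::real. sqrt (1 - s\<^sup>2))" by (intro continuous_intros)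
    ultimately have "sqrt (1 - 0\<^sup>2) = (0::real)"
      by (intro has_integral_0_cbox_imp_0[where a="-1" and b=1]) (auto simp: abs_square_le_1 simp flip: abs_le_iff)
    thus False by simp
  qed
  moreover have "half_disc_moment 0 \<ge> 0" unfolding half_disc_moment_def
    by (intro integral_nonneg half_disc_moment_integrable) (auto simp: abs_square_le_1 simp flip: abs_le_iff)
  ultimately show ?thesis by simp
qed

lemma coord_integral:
  fixes g :: "real \<Rightarrow> real"
  assumes "continuous_on UNIV g"
  shows "(\<integral>s. g s \<partial>coord_measure) = integral {-1..1} (\<lambda>s. g s * sqrt (1 - s\<^sup>2)) / half_disc_moment 0"
proof -
  let ?Z = "half_disc_moment 0"
  have Z: "integral {-1..1} (\<lambda>t. sqrt (1 - t^2)) = ?Z" by (simp add: half_disc_moment_def)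
  have nn: "0 \<le> indicator {-1..1} s * sqrt (1 - s^2) / ?Z" for s :: real
    using half_disc_moment_0_pos by (auto simp: indicator_def abs_square_le_1 simp flip: abs_le_iff)
  have [measurable]: "g \<in> borel_measurable borel" by (rule borel_measurable_continuous_onI[OF assms])
  have "(\<integral>s. g s \<partial>coord_measure)
      = (\<integral>s. (indicator {-1..1} s * sqrt (1 - s^2) / ?Z) *\<^sub>R g s \<partial>lborel)"
    unfolding coord_measure_def Z by (subst integral_density) (use nn in auto)
  also have "\<dots> = (\<integral>s. (indicator {-1..1} s *\<^sub>R (g s * sqrt (1 - s^2) / ?Z)) \<partial>lborel)"
    by (intro Bochner_Integration.integral_cong) auto
  also have "\<dots> = integral {-1..1} (\<lambda>s. g s * sqrt (1 - s^2) / ?Z)"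
    unfolding set_lebesgue_integral_def[symmetric]
    by (intro set_borel_integral_eq_integral(2) borel_integrable_compact[unfolded set_integrable_def[symmetric]])
       (auto intro!: continuous_intros continuous_on_subset[OF assms] simp: half_disc_moment_0_pos[THEN less_imp_neq, symmetric])
  finally show ?thesis by simp
qed

lemma sum_atMost_5: "(\<Sum>i\<le>5. f i) = f 0 + f 1 + f 2 + f 3 + f 4 + f 5"
  for f :: "nat \<Rightarrow> real"
  by (simp add: atMost_Suc eval_nat_numeral)

text \<open>
  The first even moments of the normalized density are \<open>1\<close>, \<open>1/4\<close> and \<open>1/8\<close>; the odd ones
  vanish. Degree 5 is what exactness of the three-node rule requires.
\<close>
lemma coord_integral_poly:
  assumes "degree p < 6"
  shows "(\<integral>s. poly p s \<partial>coord_measure) = coeff p 0 + coeff p 2 / 4 + coeff p 4 / 8"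
proof -
  let ?m = half_disc_moment
  have m: "?m (Suc 0) = 0" "?m 2 = ?m 0 / 4" "?m 3 = 0" "?m 4 = ?m 0 / 8" "?m 5 = 0"
    using half_disc_moment_Suc[of 0] half_disc_moment_Suc[of 1] half_disc_moment_Suc[of 2]
      half_disc_moment_Suc[of 3] half_disc_moment_Suc[of 4] by (simp_all add: numeral_eq_Suc)
  have "poly p s = (\<Sum>i\<le>5. coeff p i * s ^ i)" for s
    by (rule poly_altdef[of p s, THEN trans], rule sum.mono_neutral_left)
       (use assms in \<open>auto simp: coeff_eq_0\<close>)
  hence "integral {-1..1} (\<lambda>s. poly p s * sqrt (1 - s\<^sup>2))
      = integral {-1..1} (\<lambda>s. \<Sum>i\<le>5. coeff p i * (s ^ i * sqrt (1 - s\<^sup>2)))"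
    by (simp add: sum_distrib_right mult.assoc)
  also have "\<dots> = (\<Sum>i\<le>5. coeff p i * ?m i)"
    by (subst integral_sum) (auto intro!: integrable_on_mult_right half_disc_moment_integrable simp: half_disc_moment_def)
  also have "\<dots> = (coeff p 0 + coeff p 2 / 4 + coeff p 4 / 8) * ?m 0"
    unfolding sum_atMost_5 by (simp add: m algebra_simps)
  finally show ?thesis
    using half_disc_moment_0_pos by (subst coord_integral) (auto intro!: continuous_intros)
qed

lemma degree_3_expand:
  fixes p :: "real poly"
  assumes "degree p = 3" "lead_coeff p = 1"
  obtains a b c where "p = [:c, b, a, 1:]"
proof
  show "p = [:coeff p 0, coeff p 1, coeff p 2, 1:]"
  proof (rule poly_eqI)
    fix n :: nat
    consider "n = 0" | "n = 1" | "n = 2" | "n = 3" | "n > 3" by linarith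
    thus "coeff p n = coeff [:coeff p 0, coeff p 1, coeff p 2, 1:] n"
      using assms by cases (auto simp: eval_nat_numeral coeff_eq_0 coeff_pCons split: nat.splits)
  qed
qed

text \<open>
  This is one eighth of the Chebyshev polynomial of the second kind of degree 3. Uniqueness
  comes from the three orthogonality relations with \<open>1\<close>, \<open>s\<close> and \<open>s\<^sup>2\<close>, which are linear in
  the coefficients.
\<close>
lemma monic_orth_poly_coord_3: "monic_orth_poly coord_measure 3 = [:0, - 1/2, 0, 1:]"
  unfolding monic_orth_poly_def
proof (rule the_equality)
  let ?p = "[:0, - 1/2, 0, 1:] :: real poly"
  have "(\<integral>s. poly ?p s * poly q s \<partial>coord_measure) = 0" if q: "degree q < 3" for q
  proof -
    have "degree (?p * q) < 6"
      using degree_mult_le[of ?p q] q by simp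
    from coord_integral_poly[OF this] have "(\<integral>s. poly (?p * q) s \<partial>coord_measure) = 0"
      using q by (simp add: coeff_eq_0 coeff_pCons eval_nat_numeral)
    thus ?thesis by (simp only: poly_mult)
  qed
  thus "degree ?p = 3 \<and> lead_coeff ?p = 1 \<and>
    (\<forall>q. degree q < 3 \<longrightarrow> (\<integral>s. poly ?p s * poly q s \<partial>coord_measure) = 0)" by simp
next
  fix p :: "real poly"
  assume p: "degree p = 3 \<and> lead_coeff p = 1 \<and>
    (\<forall>q. degree q < 3 \<longrightarrow> (\<integral>s. poly p s * poly q s \<partial>coord_measure) = 0)"
  then obtain a b c where abc: "p = [:c, b, a, 1:]" using degree_3_expand by metis
  have e: "(\<integral>s. poly (p * q) s \<partial>coord_measure) = 0" if "degree q < 3" for q using p that by simp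
  have "c + a / 4 = 0" using e[of "1"] coord_integral_poly[of "p * 1"] by (auto simp: abc coeff_pCons eval_nat_numeral)
  moreover have "b / 4 + 1 / 8 = 0" using e[of "[:0,1:]"] coord_integral_poly[of "p * [:0,1:]"] by (auto simp: abc coeff_pCons eval_nat_numeral)
  moreover have "c / 4 + a / 8 = 0" using e[of "[:0,0,1:]"] coord_integral_poly[of "p * [:0,0,1:]"] by (auto simp: abc coeff_pCons eval_nat_numeral)
  ultimately show "p = [:0, - 1/2, 0, 1:]" by (simp add: abc)
qed

lemma zeros_orth_poly: "{s. poly (monic_orth_poly coord_measure 3) s = 0} = {- 1 / sqrt 2, 0, 1 / sqrt 2}"
proof -
  have fac: "poly [:0, - 1/2, 0, 1:] s = s * (s - 1 / sqrt 2) * (s + 1 / sqrt 2)" for s :: real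
    by (simp add: field_simps)
  have "s + 1 / sqrt 2 = 0 \<longleftrightarrow> s = - 1 / sqrt 2" for s :: real by linarith
  thus ?thesis unfolding monic_orth_poly_coord_3 fac by auto
qed

lemma eta_5_4_eq: "eta_5_4 = 1 / sqrt 2"
  unfolding eta_5_4_def zeros_orth_poly by (auto simp: max_def)

lemma gaussian_rule_coord:
  "gaussian_rule coord_measure [(- 1 / sqrt 2, 1/4), (0, 1/2), (1 / sqrt 2, 1/4)]"
proof -
  have ex: "(\<integral>s. poly p s \<partial>coord_measure)
      = 1/4 * poly p (- 1 / sqrt 2) + (1/2 * poly p 0 + 1/4 * poly p (1 / sqrt 2))"
    if "degree p < 6" for p
  proof -
    have "poly p s = (\<Sum>i\<le>5. coeff p i * s ^ i)" for s
      by (rule poly_altdef[of p s, THEN trans], rule sum.mono_neutral_left)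
         (use that in \<open>auto simp: coeff_eq_0\<close>)
    hence 1: "poly p s = coeff p 0 + coeff p 1 * s + coeff p 2 * s^2 + coeff p 3 * s^3 + coeff p 4 * s^4 + coeff p 5 * s^5" for s
      by (simp add: sum_atMost_5)
    have p4: "sqrt 2 ^ 4 = (4::real)" using power_mult[of "sqrt 2" 2 2] by simp
    show ?thesis unfolding coord_integral_poly[OF that] unfolding 1
      by (simp add: power_divide p4 add_divide_distrib diff_divide_distrib)
  qed
  have "sqrt 2 \<noteq> (0::real)" "1 / sqrt 2 > (0::real)" by simp_all
  thus ?thesis unfolding gaussian_rule_def
    using zeros_orth_poly by (auto simp: ex numeral_3_eq_3[symmetric])
qed

section \<open>The 24-cell\<close>

text \<open>
  The finite checks on normals and vertices run on lists of integer vectors, where they can be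
  decided by rewriting; the points of \<open>X24\<close> are stored multiplied by 2.
\<close>
definition int_vec :: "int \<times> int \<times> int \<times> int \<Rightarrow> real^4" where
  "int_vec = (\<lambda>(a, b, c, d). vector [of_int a, of_int b, of_int c, of_int d])"

fun int_dot :: "int \<times> int \<times> int \<times> int \<Rightarrow> int \<times> int \<times> int \<times> int \<Rightarrow> int" where
  "int_dot (a, b, c, d) (a', b', c', d') = a * a' + b * b' + c * c' + d * d'"

text \<open>
  For doubled points of \<open>X24\<close> and \<open>k = int_dot s t div 2\<close> this is the reflection of \<open>t\<close> in
  \<open>s\<close>. For \<open>k = 2\<close> and \<open>s = t\<close> it is the negation.
\<close>
fun int_axpy :: "int \<Rightarrow> int \<times> int \<times> int \<times> int \<Rightarrow> int \<times> int \<times> int \<times> int \<Rightarrow> int \<times> int \<times> int \<times> int" where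
  "int_axpy k (a, b, c, d) (a', b', c', d') = (a' - k * a, b' - k * b, c' - k * c, d' - k * d)"

definition units24 :: "(int \<times> int \<times> int \<times> int) list" where
  "units24 = [(2,0,0,0), (-2,0,0,0), (0,2,0,0), (0,-2,0,0), (0,0,2,0), (0,0,-2,0), (0,0,0,2), (0,0,0,-2),
    (1,1,1,1), (1,1,1,-1), (1,1,-1,1), (1,1,-1,-1), (1,-1,1,1), (1,-1,1,-1), (1,-1,-1,1), (1,-1,-1,-1),
    (-1,1,1,1), (-1,1,1,-1), (-1,1,-1,1), (-1,1,-1,-1), (-1,-1,1,1), (-1,-1,1,-1), (-1,-1,-1,1), (-1,-1,-1,-1)]"

text \<open>
  If \<open>t = 2 x\<close> with \<open>x\<close> in \<open>X24\<close>, then \<open>int_U t\<close> is \<open>sqrt 2\<close> times the image of \<open>x\<close> under \<open>U24\<close>;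
  the halves are integers by \<open>even_units24\<close>.
\<close>
fun int_U :: "int \<times> int \<times> int \<times> int \<Rightarrow> int \<times> int \<times> int \<times> int" where
  "int_U (a, b, c, d) = ((a + b) div 2, (a - b) div 2, (c + d) div 2, (c - d) div 2)"

definition roots24 :: "(int \<times> int \<times> int \<times> int) list" where
  "roots24 = map int_U units24"

lemma distinct_units24: "distinct units24" by code_simp
lemma distinct_roots24: "distinct roots24" by code_simp

text \<open>
  The inner products \<open>-2\<close>, \<open>0\<close>, \<open>2\<close> become \<open>- 1 / sqrt 2\<close>, \<open>0\<close>, \<open>1 / sqrt 2\<close> once the scalings
  by \<open>2\<close> and \<open>sqrt 2\<close> are undone.
\<close>
lemma count_units24:
  "\<forall>w\<in>set roots24. length (filter (\<lambda>t. int_dot w t = -2) units24) = 6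
    \<and> length (filter (\<lambda>t. int_dot w t = 0) units24) = 12
    \<and> length (filter (\<lambda>t. int_dot w t = 2) units24) = 6"
  by code_simp

lemma count_roots24:
  "\<forall>t\<in>set units24. length (filter (\<lambda>w. int_dot t w = 2) roots24) = 6
     \<and> list_all (\<lambda>w. int_dot t w \<in> {-2, 0, 2}) roots24"
  by code_simp

lemma even_units24: "\<forall>(a,b,c,d)\<in>set units24. even (a + b) \<and> even (c + d)"
  by code_simp

lemma norm_24: "\<forall>t\<in>set units24. int_dot t t = 4 \<and> int_dot (int_U t) (int_U t) = 2"
  by code_simp

lemma neg_roots24: "\<forall>t\<in>set units24. int_axpy 2 (int_U t) (int_U t) \<in> set roots24"
  by code_simp

lemma reflect_units24:
  "\<forall>s\<in>set units24. \<forall>t\<in>set units24. even (int_dot s t) \<and> int_axpy (int_dot s t div 2) s t \<in> set units24"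
  by code_simp

text \<open>
  From every point of \<open>X24\<close>, a path of two steps with inner product \<open>\<plusminus>1/2\<close> leads to \<open>e\<^sub>1\<close>.
\<close>
lemma connected_units24:
  "\<forall>t\<in>set units24. \<exists>w\<in>set units24. int_dot w (2,0,0,0) = 2 \<and> (int_dot t w = 2 \<or> int_dot t w = -2)"
  by code_simp

text \<open>
  Choosing the signs of the coordinates of a given point, these patterns turn the inequalities of
  \<open>units24\<close> and \<open>roots24\<close> into inequalities for absolute values.
\<close>
lemma sign_patterns24:
  "\<forall>p\<in>{1,-1}. \<forall>q\<in>{1,-1}. \<forall>r\<in>{1,-1}. \<forall>t\<in>{1,-1}.
     {(p,q,r,t), (2*p,0,0,0), (0,2*q,0,0), (0,0,2*r,0), (0,0,0,2*t)} \<subseteq> set units24 \<and>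
     {(p,q,0,0), (p,0,r,0), (p,0,0,t), (0,q,r,0), (0,q,0,t), (0,0,r,t)} \<subseteq> set roots24"
  by code_simp

lemma vector_4 [simp]:
  "(vector [w, x, y, z] :: 'a::zero^4) $ 1 = w" "(vector [w, x, y, z] :: 'a^4) $ 2 = x"
  "(vector [w, x, y, z] :: 'a^4) $ 3 = y" "(vector [w, x, y, z] :: 'a^4) $ 4 = z"
  by (simp_all add: vector_def)

lemma int_vec_nth [simp]:
  "int_vec (a, b, c, d) $ 1 = of_int a" "int_vec (a, b, c, d) $ 2 = of_int b"
  "int_vec (a, b, c, d) $ 3 = of_int c" "int_vec (a, b, c, d) $ 4 = of_int d"
  by (simp_all add: int_vec_def)

lemma int_vec_inner: "int_vec s \<bullet> int_vec t = of_int (int_dot s t)"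
  by (cases s; cases t) (simp add: inner_vec_def sum_4)

lemma int_vec_axpy: "int_vec (int_axpy k s t) = int_vec t - of_int k *\<^sub>R int_vec s"
  by (cases s; cases t) (simp add: vec_eq_iff forall_4)

lemma inj_int_vec: "int_vec s = int_vec t \<longleftrightarrow> s = t"
  by (cases s; cases t) (auto simp: vec_eq_iff forall_4)

lemma X24_eq: "X24 = (\<lambda>t. (1/2) *\<^sub>R int_vec t) ` set units24"
proof (intro equalityI subsetI)
  fix x assume "x \<in> X24"
  then consider i where "x = axis i 1" | i where "x = - axis i 1"
    | \<epsilon> where "x = (1/2) *\<^sub>R \<epsilon>" "\<forall>i. \<epsilon> $ i \<in> {-1, 1}"
    unfolding X24_def by blast
  thus "x \<in> (\<lambda>t. (1/2) *\<^sub>R int_vec t) ` set units24"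
  proof cases
    case 1
    have "x \<in> {(1/2) *\<^sub>R int_vec (2,0,0,0), (1/2) *\<^sub>R int_vec (0,2,0,0),
        (1/2) *\<^sub>R int_vec (0,0,2,0), (1/2) *\<^sub>R int_vec (0,0,0,2)}"
      unfolding 1 using exhaust_4[of i] by (auto simp: vec_eq_iff forall_4 axis_def)
    thus ?thesis by (auto simp: units24_def)
  next
    case 2
    have "x \<in> {(1/2) *\<^sub>R int_vec (-2,0,0,0), (1/2) *\<^sub>R int_vec (0,-2,0,0),
        (1/2) *\<^sub>R int_vec (0,0,-2,0), (1/2) *\<^sub>R int_vec (0,0,0,-2)}"
      unfolding 2 using exhaust_4[of i] by (auto simp: vec_eq_iff forall_4 axis_def)
    thus ?thesis by (auto simp: units24_def)
  next
    case 3
    define s :: "4 \<Rightarrow> int" where "s i = (if \<epsilon> $ i = 1 then 1 else -1)" for i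
    have "\<epsilon> $ i = of_int (s i)" for i using 3(2) by (auto simp: s_def)
    hence "\<epsilon> = int_vec (s 1, s 2, s 3, s 4)" by (simp add: vec_eq_iff forall_4)
    moreover have "(s 1, s 2, s 3, s 4) \<in> set units24"
      unfolding units24_def s_def by (simp split: if_split)
    ultimately show ?thesis using 3(1) by blast
  qed
next
  fix x assume "x \<in> (\<lambda>t. (1/2) *\<^sub>R int_vec t) ` set units24"
  then obtain t where t: "t \<in> set units24" "x = (1/2) *\<^sub>R int_vec t" by auto
  have ax: "axis (1::4) (1::real) = (1/2) *\<^sub>R int_vec (2,0,0,0)" "axis (2::4) (1::real) = (1/2) *\<^sub>R int_vec (0,2,0,0)"
    "axis (3::4) (1::real) = (1/2) *\<^sub>R int_vec (0,0,2,0)" "axis (4::4) (1::real) = (1/2) *\<^sub>R int_vec (0,0,0,2)"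
    "- axis (1::4) (1::real) = (1/2) *\<^sub>R int_vec (-2,0,0,0)" "- axis (2::4) (1::real) = (1/2) *\<^sub>R int_vec (0,-2,0,0)"
    "- axis (3::4) (1::real) = (1/2) *\<^sub>R int_vec (0,0,-2,0)" "- axis (4::4) (1::real) = (1/2) *\<^sub>R int_vec (0,0,0,-2)"
    by (simp_all add: vec_eq_iff forall_4 axis_def)
  have "t \<in> set (take 8 units24) \<or> t \<in> set (drop 8 units24)"
    using t(1) by (metis UnE append_take_drop_id set_append)
  thus "x \<in> X24"
  proof
    assume "t \<in> set (take 8 units24)"
    hence "x \<in> {axis i 1 | i. True} \<union> {- axis i 1 | i. True}"
      unfolding t(2) units24_def by (auto simp: ax[symmetric])
    thus ?thesis unfolding X24_def by blast
  next
    assume "t \<in> set (drop 8 units24)"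
    hence "\<forall>i. int_vec t $ i \<in> {-1, 1}"
      unfolding units24_def by (auto simp: forall_4)
    thus ?thesis unfolding X24_def t(2) by blast
  qed
qed

lemma inj_half_int_vec: "inj_on (\<lambda>t. (1/2) *\<^sub>R int_vec t) A"
  by (auto simp: inj_on_def inj_int_vec)

lemma finite_X24: "finite X24" by (simp add: X24_eq)

lemma card_X24: "card X24 = 24"
  unfolding X24_eq card_image[OF inj_half_int_vec] distinct_card[OF distinct_units24]
  by (simp add: units24_def)

lemma card_X24_Collect:
  assumes "\<And>t. t \<in> set units24 \<Longrightarrow> Q ((1/2) *\<^sub>R int_vec t) \<longleftrightarrow> R t"
  shows "card {y \<in> X24. Q y} = length (filter R units24)"
proof -
  have "{y \<in> X24. Q y} = (\<lambda>t. (1/2) *\<^sub>R int_vec t) ` set (filter R units24)"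
    unfolding X24_eq using assms by auto
  thus ?thesis
    by (simp only: card_image[OF inj_half_int_vec] distinct_card distinct_filter distinct_units24)
qed

lemma norm_X24: "v \<in> X24 \<Longrightarrow> norm v = 1"
  using norm_24 by (auto simp: X24_eq norm_eq_1 int_vec_inner)

lemma reflect_X24:
  assumes "u \<in> X24" "v \<in> X24"
  shows "reflect u v \<in> X24"
proof -
  obtain s t where st: "s \<in> set units24" "t \<in> set units24"
    "u = (1/2) *\<^sub>R int_vec s" "v = (1/2) *\<^sub>R int_vec t" using assms unfolding X24_eq by auto
  let ?k = "int_dot s t div 2"
  have ev: "even (int_dot s t)" and m: "int_axpy ?k s t \<in> set units24"
    using reflect_units24 st by auto
  have "real_of_int (int_dot s t) = 2 * real_of_int ?k" using ev by (auto elim: evenE)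
  hence "reflect u v = (1/2) *\<^sub>R int_vec (int_axpy ?k s t)"
    unfolding reflect_def st int_vec_axpy by (simp add: int_vec_inner algebra_simps)
  thus ?thesis using m unfolding X24_eq by blast
qed

text \<open>
  If \<open>u \<bullet> v = 1/2\<close>, then \<open>u - v\<close> is again in \<open>X24\<close> and the reflection in it exchanges \<open>u\<close> and
  \<open>v\<close>; the reflection in \<open>u\<close> itself exchanges \<open>u\<close> and \<open>-u\<close>. These two moves connect \<open>X24\<close>.
\<close>
lemma reflection_invariant_constant_on_X24:
  assumes inv: "\<And>u v. u \<in> X24 \<Longrightarrow> v \<in> X24 \<Longrightarrow> h (reflect u v) = h v"
    and "v \<in> X24"
  shows "h v = h (axis 1 1)"
proof -
  have neg: "- u \<in> X24 \<and> h (- u) = h u" if "u \<in> X24" for u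
    using inv[OF that that] reflect_X24[OF that that] norm_X24[OF that]
    by (simp add: reflect_def norm_eq_1 scaleR_2)
  have adj: "h u = h v" if uv: "u \<in> X24" "v \<in> X24" "u \<bullet> v = 1/2" for u v
  proof -
    have n: "u \<bullet> u = 1" "v \<bullet> v = 1" using norm_X24 uv by (auto simp: norm_eq_1)
    have "2 * (v \<bullet> u) = 1" using uv(3) by (simp add: inner_commute)
    hence "reflect v u = u - v" by (simp only: reflect_def scaleR_one)
    hence m: "u - v \<in> X24" using reflect_X24[OF uv(2,1)] by simp
    have "2 * ((u - v) \<bullet> u) = 1" using uv(3) n by (simp add: inner_diff_left inner_commute[of v u])
    hence "reflect (u - v) u = v" by (simp only: reflect_def scaleR_one) simp
    thus ?thesis using inv[OF m uv(1)] by simp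
  qed
  have e1: "axis 1 1 = (1/2) *\<^sub>R int_vec (2,0,0,0)"
    by (simp add: vec_eq_iff forall_4 axis_def)
  have e1X: "axis 1 1 \<in> X24" unfolding X24_def by blast
  obtain t where t: "t \<in> set units24" "v = (1/2) *\<^sub>R int_vec t" using assms(2) unfolding X24_eq by auto
  obtain w where w: "w \<in> set units24" "int_dot w (2,0,0,0) = 2" "int_dot t w = 2 \<or> int_dot t w = -2"
    using connected_units24 t(1) by blast
  define x where "x = (1/2) *\<^sub>R int_vec w"
  have x: "x \<in> X24" using w(1) unfolding x_def X24_eq by blast
  have "x \<bullet> axis 1 1 = 1/2" unfolding x_def e1 using w(2) by (simp add: int_vec_inner)
  hence "h x = h (axis 1 1)" by (rule adj[OF x e1X])
  moreover have "h v = h x"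
  proof (cases "int_dot t w = 2")
    case True
    thus ?thesis by (intro adj assms(2) x) (simp add: t(2) x_def int_vec_inner)
  next
    case False
    hence "h (- v) = h x" using w(3)
      by (intro adj x) (use neg[OF assms(2)] in \<open>simp_all add: t(2) x_def int_vec_inner\<close>)
    thus ?thesis using neg[OF assms(2)] by simp
  qed
  ultimately show ?thesis by simp
qed

text \<open>
  The 24 vectors \<open>\<plusminus>e\<^sub>i \<plusminus> e\<^sub>j\<close>, the vertices of the 24-cell of inradius 1.
\<close>
definition d4_roots :: "(real^4) set" where
  "d4_roots = int_vec ` set roots24"

lemma U24_int_vec:
  assumes "t \<in> set units24"
  shows "U24 *v ((1/2) *\<^sub>R int_vec t) = (1 / sqrt 2) *\<^sub>R int_vec (int_U t)"
proof -
  obtain a b c d where t: "t = (a, b, c, d)" by (cases t)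
  have "even (a + b)" "even (c + d)" using even_units24 assms t by auto
  hence e: "real_of_int ((a + b) div 2) = (real_of_int a + real_of_int b) / 2"
    "real_of_int ((a - b) div 2) = (real_of_int a - real_of_int b) / 2"
    "real_of_int ((c + d) div 2) = (real_of_int c + real_of_int d) / 2"
    "real_of_int ((c - d) div 2) = (real_of_int c - real_of_int d) / 2"
    by (simp_all add: real_of_int_div)
  show ?thesis
    by (simp add: t U24_def vec_eq_iff forall_4 matrix_vector_mult_def sum_4 e) (simp add: field_simps)
qed

lemma U24_X24: "(\<lambda>v. U24 *v v) ` X24 = (\<lambda>w. (1 / sqrt 2) *\<^sub>R w) ` d4_roots"
  unfolding X24_eq d4_roots_def roots24_def set_map image_image
  by (intro image_cong refl U24_int_vec)

lemma transpose_U24: "transpose U24 = U24"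
  by (simp add: U24_def transpose_def vec_eq_iff forall_4)

lemma U24_involution: "U24 *v (U24 *v x) = x"
  by (simp add: U24_def vec_eq_iff forall_4 matrix_vector_mult_def sum_4 field_simps)

lemma orthogonal_matrix_U24: "orthogonal_matrix U24"
  unfolding orthogonal_matrix transpose_U24
  by (simp add: matrix_eq U24_involution flip: matrix_vector_mul_assoc)

lemma inner_U24: "(U24 *v x) \<bullet> y = x \<bullet> (U24 *v y)"
  by (metis dot_lmul_matrix transpose_U24 transpose_matrix_vector)

lemma norm_d4_roots: "w \<in> d4_roots \<Longrightarrow> norm w = sqrt 2"
  using norm_24 by (auto simp: d4_roots_def roots24_def norm_eq_sqrt_inner int_vec_inner)

lemma uminus_d4_roots:
  assumes "w \<in> d4_roots" shows "- w \<in> d4_roots"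
proof -
  obtain t where t: "t \<in> set units24" "w = int_vec (int_U t)"
    using assms by (auto simp: d4_roots_def roots24_def)
  have "- w = int_vec (int_axpy 2 (int_U t) (int_U t))" by (simp add: int_vec_axpy t(2) scaleR_2)
  thus ?thesis using neg_roots24 t(1) by (simp add: d4_roots_def)
qed

lemma inner_X24_d4_roots:
  assumes "v \<in> X24" "w \<in> d4_roots"
  shows "v \<bullet> w \<in> {-1, 0, 1}"
proof -
  obtain t s where ts: "t \<in> set units24" "v = (1/2) *\<^sub>R int_vec t" "s \<in> set roots24" "w = int_vec s"
    using assms by (auto simp: X24_eq d4_roots_def)
  have "int_dot t s \<in> {-2, 0, 2}" using count_roots24 ts by (auto simp: list_all_iff)
  thus ?thesis by (auto simp: ts int_vec_inner)
qed

lemma card_d4_roots_on_facet: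
  assumes "v \<in> X24"
  shows "card {w \<in> d4_roots. v \<bullet> w = 1} = 6"
proof -
  obtain t where t: "t \<in> set units24" "v = (1/2) *\<^sub>R int_vec t" using assms by (auto simp: X24_eq)
  have "{w \<in> d4_roots. v \<bullet> w = 1} = int_vec ` set (filter (\<lambda>w. int_dot t w = 2) roots24)"
    by (auto simp: d4_roots_def t int_vec_inner)
  moreover have "inj_on int_vec A" for A by (auto simp: inj_on_def inj_int_vec)
  ultimately show ?thesis
    using count_roots24 t(1) by (simp add: card_image distinct_card distinct_roots24 del: set_filter)
qed

lemma card_facet_row:
  assumes "x \<in> X24"
  shows "card {y \<in> X24. (U24 *v x) \<bullet> y = - 1 / sqrt 2} = 6"
    "card {y \<in> X24. (U24 *v x) \<bullet> y = 0} = 12"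
    "card {y \<in> X24. (U24 *v x) \<bullet> y = 1 / sqrt 2} = 6"
    "(\<lambda>y. (U24 *v x) \<bullet> y) ` X24 \<subseteq> {- 1 / sqrt 2, 0, 1 / sqrt 2}"
proof -
  obtain s where s: "s \<in> set units24" "x = (1/2) *\<^sub>R int_vec s" using assms by (auto simp: X24_eq)
  define w where "w = int_U s"
  have w: "w \<in> set roots24" using s(1) by (simp add: w_def roots24_def)
  have Ux: "U24 *v x = (1 / sqrt 2) *\<^sub>R int_vec w" unfolding s(2) w_def by (rule U24_int_vec[OF s(1)])
  have row: "(U24 *v x) \<bullet> ((1/2) *\<^sub>R int_vec t) = of_int (int_dot w t) / 2 / sqrt 2" for t
    by (simp add: Ux int_vec_inner)
  have sq: "sqrt 2 \<noteq> (0::real)" by simp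
  have "card {y \<in> X24. (U24 *v x) \<bullet> y = - 1 / sqrt 2} = length (filter (\<lambda>t. int_dot w t = -2) units24)"
    by (rule card_X24_Collect) (unfold row, use sq in \<open>auto simp: divide_simps\<close>)
  thus "card {y \<in> X24. (U24 *v x) \<bullet> y = - 1 / sqrt 2} = 6" using count_units24 w by simp
  have "card {y \<in> X24. (U24 *v x) \<bullet> y = 0} = length (filter (\<lambda>t. int_dot w t = 0) units24)"
    by (rule card_X24_Collect) (unfold row, use sq in \<open>auto simp: divide_simps\<close>)
  thus "card {y \<in> X24. (U24 *v x) \<bullet> y = 0} = 12" using count_units24 w by simp
  have "card {y \<in> X24. (U24 *v x) \<bullet> y = 1 / sqrt 2} = length (filter (\<lambda>t. int_dot w t = 2) units24)"
    by (rule card_X24_Collect) (unfold row, use sq in \<open>auto simp: divide_simps\<close>)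
  thus "card {y \<in> X24. (U24 *v x) \<bullet> y = 1 / sqrt 2} = 6" using count_units24 w by simp
  have wr: "int_vec w \<in> d4_roots" using w by (simp add: d4_roots_def)
  show "(\<lambda>y. (U24 *v x) \<bullet> y) ` X24 \<subseteq> {- 1 / sqrt 2, 0, 1 / sqrt 2}"
  proof
    fix a assume "a \<in> (\<lambda>y. (U24 *v x) \<bullet> y) ` X24"
    then obtain y where y: "y \<in> X24" "a = (y \<bullet> int_vec w) / sqrt 2" by (auto simp: Ux inner_commute)
    show "a \<in> {- 1 / sqrt 2, 0, 1 / sqrt 2}"
      unfolding y(2) using inner_X24_d4_roots[OF y(1) wr] by auto
  qed
qed

lemma facet_row_realizes_rule:
  assumes "x \<in> X24"
  shows "realizes_rule X24 (\<lambda>y. (U24 *v x) \<bullet> y) [(- 1 / sqrt 2, 1/4), (0, 1/2), (1 / sqrt 2, 1/4)]"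
proof -
  note c = card_facet_row[OF assms]
  have ex: "s \<in> (\<lambda>y. (U24 *v x) \<bullet> y) ` X24" if "card {y \<in> X24. (U24 *v x) \<bullet> y = s} \<noteq> 0" for s
  proof -
    have "{y \<in> X24. (U24 *v x) \<bullet> y = s} \<noteq> {}" using that by (metis card.empty)
    thus ?thesis by auto
  qed
  have "(\<lambda>y. (U24 *v x) \<bullet> y) ` X24 = {- 1 / sqrt 2, 0, 1 / sqrt 2}"
    using c(4) ex[of "- 1 / sqrt 2"] ex[of 0] ex[of "1 / sqrt 2"] c(1-3) by auto
  thus ?thesis unfolding realizes_rule_def using c(1-3) card_X24 by auto
qed

definition cell24 :: "(real^4) set" where
  "cell24 = {y. \<forall>v\<in>X24. v \<bullet> y \<le> 1}"

lemma weighted_sum_le_1_dominant: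
  fixes a b c d a' b' c' d' :: real
  assumes "0 \<le> b" "0 \<le> c" "0 \<le> d" "a \<le> 1" "a + b + c + d \<le> 2"
    and "0 \<le> b'" "a' \<ge> 1/2" "a' + b' \<le> 1" "a' + c' \<le> 1" "a' + d' \<le> 1"
  shows "a * a' + b * b' + c * c' + d * d' \<le> 1"
proof -
  have "b * b' \<le> b * (1 - a')" "c * c' \<le> c * (1 - a')" "d * d' \<le> d * (1 - a')"
    using assms by (auto intro!: mult_left_mono)
  moreover have "(b + c + d) * (1 - a') \<le> (2 - a) * (1 - a')"
    using assms by (intro mult_right_mono) auto
  moreover have "0 \<le> (1 - a) * (2 * a' - 1)" using assms by simp
  ultimately show ?thesis by (simp add: algebra_simps)
qed

text \<open>
  The inequality between the 24-cell and its polar, after taking absolute values of the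
  coordinates: \<open>(a, b, c, d)\<close> satisfies the facet inequalities and the primed weights the vertex
  inequalities. If no weight exceeds \<open>1/2\<close>, the bound on \<open>a + b + c + d\<close> suffices; otherwise the
  single large weight limits the other ones.
\<close>
lemma weighted_sum_le_1:
  fixes a b c d a' b' c' d' :: real
  assumes nn: "0 \<le> a" "0 \<le> b" "0 \<le> c" "0 \<le> d" "0 \<le> a'" "0 \<le> b'" "0 \<le> c'" "0 \<le> d'"
    and le: "a \<le> 1" "b \<le> 1" "c \<le> 1" "d \<le> 1" "a + b + c + d \<le> 2"
    and pair: "a' + b' \<le> 1" "a' + c' \<le> 1" "a' + d' \<le> 1" "b' + c' \<le> 1" "b' + d' \<le> 1" "c' + d' \<le> 1"
  shows "a * a' + b * b' + c * c' + d * d' \<le> 1"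
proof -
  consider "a' \<ge> 1/2" | "b' \<ge> 1/2" | "c' \<ge> 1/2" | "d' \<ge> 1/2"
    | "a' \<le> 1/2" "b' \<le> 1/2" "c' \<le> 1/2" "d' \<le> 1/2" by linarith
  thus ?thesis
  proof cases
    case 1 thus ?thesis using weighted_sum_le_1_dominant[of b c d a b' a' c' d'] assms by linarith
  next
    case 2 thus ?thesis using weighted_sum_le_1_dominant[of a c d b a' b' c' d'] assms by linarith
  next
    case 3 thus ?thesis using weighted_sum_le_1_dominant[of a b d c a' c' b' d'] assms by linarith
  next
    case 4 thus ?thesis using weighted_sum_le_1_dominant[of a b c d a' d' b' c'] assms by linarith
  next
    case 5
    have "a * a' \<le> a * (1/2)" "b * b' \<le> b * (1/2)" "c * c' \<le> c * (1/2)" "d * d' \<le> d * (1/2)"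
      by (intro mult_left_mono 5 nn)+
    thus ?thesis using le(5) by linarith
  qed
qed

text \<open>
  The polar of the vertex set is contained in the polar of the 24-cell. Both the vertex
  description \<open>cell24_eq_hull\<close> and the computation of the polar body rest on this.
\<close>
lemma inner_cell24_le_1:
  assumes y: "y \<in> cell24" and z: "\<And>w. w \<in> d4_roots \<Longrightarrow> w \<bullet> z \<le> 1"
  shows "y \<bullet> z \<le> 1"
proof -
  have Y: "int_vec t \<bullet> y \<le> 2" if "t \<in> set units24" for t
  proof -
    have "((1/2) *\<^sub>R int_vec t) \<bullet> y \<le> 1" using y that unfolding cell24_def X24_eq by blast
    thus ?thesis by simp
  qed
  have i: "int_vec (a,b,c,d) \<bullet> x = of_int a * x$1 + of_int b * x$2 + of_int c * x$3 + of_int d * x$4" for a b c d x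
    by (simp add: inner_vec_def sum_4)
  have Z: "int_vec w \<bullet> z \<le> 1" if "w \<in> set roots24" for w using z that by (auto simp: d4_roots_def)
  have "\<exists>s::int. s \<in> {1, -1} \<and> \<bar>x\<bar> = of_int s * x" for x :: real
    by (cases "x \<ge> 0") (auto intro: exI[of _ 1] exI[of _ "-1"])
  then obtain s :: "real \<Rightarrow> int" where s: "\<And>x. s x \<in> {1, -1}" "\<And>x. \<bar>x\<bar> = of_int (s x) * x" by metis
  note pat = sign_patterns24[THEN bspec, OF s(1), THEN bspec, OF s(1), THEN bspec, OF s(1), THEN bspec, OF s(1)]
  have *: "{(s (x$1), s (x$2), s (x$3), s (x$4)), (2 * s (x$1),0,0,0), (0,2 * s (x$2),0,0),
        (0,0,2 * s (x$3),0), (0,0,0,2 * s (x$4))} \<subseteq> set units24"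
    "{(s (x$1),s (x$2),0,0), (s (x$1),0,s (x$3),0), (s (x$1),0,0,s (x$4)),
      (0,s (x$2),s (x$3),0), (0,s (x$2),0,s (x$4)), (0,0,s (x$3),s (x$4))} \<subseteq> set roots24" for x :: "real^4"
    using pat by blast+
  have "\<forall>t\<in>{(s (y$1), s (y$2), s (y$3), s (y$4)), (2 * s (y$1),0,0,0), (0,2 * s (y$2),0,0),
        (0,0,2 * s (y$3),0), (0,0,0,2 * s (y$4))}. int_vec t \<bullet> y \<le> 2"
    using *(1)[of y] Y by blast
  hence y1: "\<bar>y$1\<bar> \<le> 1" "\<bar>y$2\<bar> \<le> 1" "\<bar>y$3\<bar> \<le> 1" "\<bar>y$4\<bar> \<le> 1"
    and y2: "\<bar>y$1\<bar> + \<bar>y$2\<bar> + \<bar>y$3\<bar> + \<bar>y$4\<bar> \<le> 2"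
    unfolding s(2) by (simp_all add: i)
  have "\<forall>w\<in>{(s (z$1),s (z$2),0,0), (s (z$1),0,s (z$3),0), (s (z$1),0,0,s (z$4)),
      (0,s (z$2),s (z$3),0), (0,s (z$2),0,s (z$4)), (0,0,s (z$3),s (z$4))}. int_vec w \<bullet> z \<le> 1"
    using *(2)[of z] Z by blast
  hence z1: "\<bar>z$1\<bar> + \<bar>z$2\<bar> \<le> 1" "\<bar>z$1\<bar> + \<bar>z$3\<bar> \<le> 1" "\<bar>z$1\<bar> + \<bar>z$4\<bar> \<le> 1"
    "\<bar>z$2\<bar> + \<bar>z$3\<bar> \<le> 1" "\<bar>z$2\<bar> + \<bar>z$4\<bar> \<le> 1" "\<bar>z$3\<bar> + \<bar>z$4\<bar> \<le> 1"
    unfolding s(2) by (simp_all add: i)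
  have "y \<bullet> z \<le> \<bar>y$1\<bar> * \<bar>z$1\<bar> + \<bar>y$2\<bar> * \<bar>z$2\<bar> + \<bar>y$3\<bar> * \<bar>z$3\<bar> + \<bar>y$4\<bar> * \<bar>z$4\<bar>"
    unfolding inner_vec_def sum_4 inner_real_def abs_mult[symmetric] by (intro add_mono abs_ge_self)
  also have "\<dots> \<le> 1" by (intro weighted_sum_le_1 abs_ge_zero y1 y2 z1)
  finally show ?thesis .
qed

lemma convex_cell24: "convex cell24"
proof -
  have e: "cell24 = (\<Inter>v\<in>X24. {y. v \<bullet> y \<le> 1})" by (auto simp: cell24_def)
  show ?thesis unfolding e by (intro convex_INT convex_halfspace_le)
qed

lemma finite_d4_roots: "finite d4_roots" by (simp add: d4_roots_def)

text \<open>
  A point of the cell outside of the hull could be separated from the vertices; since these are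
  symmetric about the origin, the separating functional can be scaled so as to
  contradict \<open>inner_cell24_le_1\<close>.
\<close>
lemma cell24_eq_hull: "cell24 = convex hull d4_roots"
proof
  show "convex hull d4_roots \<subseteq> cell24"
  proof (rule hull_minimal[where S = convex])
    show "d4_roots \<subseteq> cell24" unfolding cell24_def using inner_X24_d4_roots by fastforce
  qed (rule convex_cell24)
  show "cell24 \<subseteq> convex hull d4_roots"
  proof (rule ccontr)
    assume "\<not> cell24 \<subseteq> convex hull d4_roots"
    then obtain y where y: "y \<in> cell24" "y \<notin> convex hull d4_roots" by blast
    have "closed (convex hull d4_roots)"
      by (intro compact_imp_closed compact_convex_hull finite_imp_compact finite_d4_roots)
    from separating_hyperplane_closed_point[OF convex_convex_hull this y(2)]
    obtain a b where ab: "a \<bullet> y < b" "\<forall>x\<in>convex hull d4_roots. a \<bullet> x > b" by blast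
    have inroots: "a \<bullet> w > b" if "w \<in> d4_roots" for w using ab(2) that by (simp add: hull_inc)
    obtain w where w: "w \<in> d4_roots" unfolding d4_roots_def roots24_def units24_def by auto
    have "a \<bullet> w > b" "a \<bullet> (- w) > b" using inroots w uminus_d4_roots by blast+
    hence b: "b < 0" by simp
    have "y \<bullet> ((1 / b) *\<^sub>R a) \<le> 1"
    proof (rule inner_cell24_le_1[OF y(1)])
      fix w assume "w \<in> d4_roots"
      thus "w \<bullet> ((1 / b) *\<^sub>R a) \<le> 1" using inroots[of w] b by (simp add: divide_simps inner_commute)
    qed
    thus False using ab(1) b by (simp add: divide_simps inner_commute)
  qed
qed

lemma cell24_subset_cball: "cell24 \<subseteq> cball 0 (sqrt 2)"
  unfolding cell24_eq_hull by (rule hull_minimal[where S = convex]) (auto simp: norm_d4_roots)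

text \<open>
  All vertices lie on the sphere of radius \<open>sqrt 2\<close>, which encloses the cell, and a point of a
  sphere is never an interior point of a segment within its ball.
\<close>
lemma extreme_point_of_cell24: "w extreme_point_of cell24 \<longleftrightarrow> w \<in> d4_roots"
proof
  assume "w extreme_point_of cell24"
  thus "w \<in> d4_roots" unfolding cell24_eq_hull by (rule extreme_point_of_convex_hull)
next
  assume w: "w \<in> d4_roots"
  have "w \<in> cell24" unfolding cell24_eq_hull using w by (rule hull_inc)
  moreover have "w \<notin> open_segment a b" if ab: "a \<in> cell24" "b \<in> cell24" for a b
  proof
    assume "w \<in> open_segment a b"
    hence "norm w < norm a \<or> norm w < norm b"
      using dist_decreases_open_segment[of w a b 0] by (simp add: dist_norm) 
    thus False using cell24_subset_cball ab norm_d4_roots[OF w] by auto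
  qed
  ultimately show "w extreme_point_of cell24" by (auto simp: extreme_point_of_def)
qed

section \<open>The Minkowski polytope of the 24-cell\<close>

text \<open>
  By reflection symmetry the support numbers have a common value \<open>r\<close>. It is positive because
  otherwise the inequalities of the opposite normals \<open>\<plusminus>e\<^sub>i\<close> would leave at most the origin.
\<close>
lemma minkowski_polytope_X24_is_cell24:
  assumes "minkowski_polytope X24 P" "steiner_point P = 0"
  obtains r where "r > 0" "\<And>v. v \<in> X24 \<Longrightarrow> support_fun P v = r" "P = (\<lambda>y. r *\<^sub>R y) ` cell24"
proof -
  note S = minkowski_polytope_structure[OF assms(1)]
  define r where "r = support_fun P (axis 1 1)"
  have h: "support_fun P v = r" if "v \<in> X24" for v
    unfolding r_def
  proof (rule reflection_invariant_constant_on_X24[OF _ that])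
    fix u v assume "u \<in> X24" "v \<in> X24"
    thus "support_fun P (reflect u v) = support_fun P v"
      using reflect_X24 norm_X24 by (intro minkowski_polytope_reflection_symmetric[OF assms finite_X24]) auto
  qed
  have P: "P = {y. \<forall>v\<in>X24. v \<bullet> y \<le> r}" using S(3) h by simp
  have r: "r > 0"
  proof (rule ccontr)
    assume "\<not> r > 0"
    have "y = 0" if "y \<in> P" for y
    proof -
      have "y $ i = 0" for i
      proof -
        have "axis i 1 \<in> X24" "- axis i 1 \<in> X24" unfolding X24_def by blast+
        hence "axis i 1 \<bullet> y \<le> r" "(- axis i 1) \<bullet> y \<le> r" using that P by blast+
        thus ?thesis using \<open>\<not> r > 0\<close> by (simp add: inner_axis')
      qed
      thus ?thesis by (simp add: vec_eq_iff)
    qed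
    hence "aff_dim P \<le> aff_dim {0 :: real^4}" by (intro aff_dim_subset) auto
    moreover have "aff_dim P = 4" using assms(1) by (simp add: minkowski_polytope_def)
    ultimately show False by simp
  qed
  have "P = (\<lambda>y. r *\<^sub>R y) ` cell24"
  proof (intro equalityI subsetI)
    fix y assume "y \<in> P"
    hence "(1 / r) *\<^sub>R y \<in> cell24" using r by (auto simp: P cell24_def divide_simps)
    moreover have "y = r *\<^sub>R ((1 / r) *\<^sub>R y)" using r by simp
    ultimately show "y \<in> (\<lambda>y. r *\<^sub>R y) ` cell24" by blast
  next
    fix y assume "y \<in> (\<lambda>y. r *\<^sub>R y) ` cell24"
    then obtain x where x: "x \<in> cell24" "y = r *\<^sub>R x" by blast
    have "v \<bullet> y \<le> r" if "v \<in> X24" for v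
    proof -
      have "r * (v \<bullet> x) \<le> r * 1" using x(1) that r by (intro mult_left_mono) (auto simp: cell24_def)
      thus ?thesis by (simp add: x(2))
    qed
    thus "y \<in> P" by (simp add: P)
  qed
  thus ?thesis using that r h by blast
qed

lemma d4_roots_subset_cell24: "d4_roots \<subseteq> cell24"
  unfolding cell24_eq_hull by (rule hull_subset)

lemma d4_roots_nonempty: "d4_roots \<noteq> {}"
  by (simp add: d4_roots_def roots24_def units24_def)

lemma centered_inradius_cell24:
  assumes r: "r > 0"
  shows "centered_inradius ((\<lambda>y. r *\<^sub>R y) ` cell24) = r"
  unfolding centered_inradius_def
proof (rule Greatest_equality)
  let ?P = "(\<lambda>y. r *\<^sub>R y) ` cell24"
  have "y \<in> ?P" if y: "norm y \<le> r" for y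
  proof -
    have "(1 / r) *\<^sub>R y \<in> cell24" unfolding cell24_def
    proof safe
      fix v assume "v \<in> X24"
      hence "v \<bullet> y \<le> r" using norm_cauchy_schwarz[of v y] norm_X24[of v] y by simp
      thus "v \<bullet> ((1 / r) *\<^sub>R y) \<le> 1" using r by (simp add: divide_simps)
    qed
    moreover have "y = r *\<^sub>R ((1 / r) *\<^sub>R y)" using r by simp
    ultimately show ?thesis by blast
  qed
  thus "0 \<le> r \<and> cball 0 r \<subseteq> ?P" using r by auto
next
  fix \<rho> assume \<rho>: "0 \<le> \<rho> \<and> cball 0 \<rho> \<subseteq> (\<lambda>y. r *\<^sub>R y) ` cell24"
  let ?e = "axis 1 1 :: real^4"
  have "\<rho> *\<^sub>R ?e \<in> cball 0 \<rho>" using \<rho> by simp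
  then obtain x where x: "x \<in> cell24" "\<rho> *\<^sub>R ?e = r *\<^sub>R x" using \<rho> by blast
  have "?e \<in> X24" unfolding X24_def by blast
  hence "?e \<bullet> x \<le> 1" using x(1) by (auto simp: cell24_def)
  hence "r * (?e \<bullet> x) \<le> r * 1" using r by (intro mult_left_mono) auto
  moreover have "?e \<bullet> (\<rho> *\<^sub>R ?e) = \<rho>" by (simp add: inner_axis_axis)
  ultimately show "\<rho> \<le> r" unfolding x(2) by simp
qed

lemma centered_circumradius_cell24:
  assumes r: "r > 0"
  shows "centered_circumradius ((\<lambda>y. r *\<^sub>R y) ` cell24) = r * sqrt 2"
  unfolding centered_circumradius_def
proof (rule Least_equality)
  show "0 \<le> r * sqrt 2 \<and> (\<lambda>y. r *\<^sub>R y) ` cell24 \<subseteq> cball 0 (r * sqrt 2)"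
    using r cell24_subset_cball by (auto simp: subset_iff)
next
  fix \<rho> assume \<rho>: "0 \<le> \<rho> \<and> (\<lambda>y. r *\<^sub>R y) ` cell24 \<subseteq> cball 0 \<rho>"
  obtain w where w: "w \<in> d4_roots" using d4_roots_nonempty by blast
  hence "r *\<^sub>R w \<in> cball 0 \<rho>" using d4_roots_subset_cell24 \<rho> by blast
  thus "r * sqrt 2 \<le> \<rho>" using norm_d4_roots[OF w] r by simp
qed

text \<open>
  Polarity exchanges facet and vertex inequalities, and \<open>U24\<close> carries the facet normals to the
  vertices divided by \<open>sqrt 2\<close>.
\<close>
lemma polar_body_cell24:
  assumes r: "r > 0"
  shows "polar_body ((\<lambda>y. r *\<^sub>R y) ` cell24)
    = (\<lambda>y. (1 / (r\<^sup>2 * sqrt 2)) *\<^sub>R (U24 *v y)) ` (\<lambda>y. r *\<^sub>R y) ` cell24"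
proof -
  have polar: "z \<in> polar_body ((\<lambda>y. r *\<^sub>R y) ` cell24) \<longleftrightarrow> (\<forall>w\<in>d4_roots. r * (w \<bullet> z) \<le> 1)" for z
  proof
    assume "z \<in> polar_body ((\<lambda>y. r *\<^sub>R y) ` cell24)"
    thus "\<forall>w\<in>d4_roots. r * (w \<bullet> z) \<le> 1"
      using d4_roots_subset_cell24 by (auto simp: polar_body_def inner_commute)
  next
    assume *: "\<forall>w\<in>d4_roots. r * (w \<bullet> z) \<le> 1"
    have "y \<bullet> (r *\<^sub>R z) \<le> 1" if "y \<in> cell24" for y
      by (rule inner_cell24_le_1[OF that]) (use * in simp)
    thus "z \<in> polar_body ((\<lambda>y. r *\<^sub>R y) ` cell24)" by (auto simp: polar_body_def inner_commute)
  qed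
  have mem: "y \<in> cell24 \<longleftrightarrow> (\<forall>w\<in>d4_roots. w \<bullet> (U24 *v y) \<le> sqrt 2)" for y
  proof -
    have "y \<in> cell24 \<longleftrightarrow> (\<forall>v\<in>(\<lambda>v. U24 *v v) ` X24. v \<bullet> (U24 *v y) \<le> 1)"
      by (simp add: cell24_def inner_U24 U24_involution)
    thus ?thesis unfolding U24_X24 by (simp add: divide_simps)
  qed
  have img: "(\<lambda>y. (1 / (r\<^sup>2 * sqrt 2)) *\<^sub>R (U24 *v y)) ` (\<lambda>y. r *\<^sub>R y) ` cell24
      = (\<lambda>y. (1 / (r * sqrt 2)) *\<^sub>R (U24 *v y)) ` cell24"
    unfolding image_image using r
    by (intro image_cong refl) (simp add: matrix_vector_mult_scaleR power2_eq_square)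
  show ?thesis unfolding img
  proof (intro equalityI subsetI)
    fix z assume z: "z \<in> polar_body ((\<lambda>y. r *\<^sub>R y) ` cell24)"
    define y where "y = U24 *v ((r * sqrt 2) *\<^sub>R z)"
    have "w \<bullet> (U24 *v y) \<le> sqrt 2" if "w \<in> d4_roots" for w
    proof -
      have "sqrt 2 * (r * (w \<bullet> z)) \<le> sqrt 2 * 1"
        using z polar that by (intro mult_left_mono) auto
      thus ?thesis by (simp add: y_def U24_involution mult_ac)
    qed
    hence "y \<in> cell24" using mem by blast
    moreover have "z = (1 / (r * sqrt 2)) *\<^sub>R (U24 *v y)"
      using r by (simp add: y_def U24_involution)
    ultimately show "z \<in> (\<lambda>y. (1 / (r * sqrt 2)) *\<^sub>R (U24 *v y)) ` cell24" by blast
  next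
    fix z assume "z \<in> (\<lambda>y. (1 / (r * sqrt 2)) *\<^sub>R (U24 *v y)) ` cell24"
    then obtain y where y: "y \<in> cell24" "z = (1 / (r * sqrt 2)) *\<^sub>R (U24 *v y)" by blast
    have "r * (w \<bullet> z) \<le> 1" if "w \<in> d4_roots" for w
      using mem y(1) that r by (simp add: y(2) divide_simps)
    thus "z \<in> polar_body ((\<lambda>y. r *\<^sub>R y) ` cell24)" using polar by blast
  qed
qed

lemma extreme_points_of_linear_image:
  assumes "linear f" "inj f"
  shows "{x. x extreme_point_of (f ` S)} = f ` {x. x extreme_point_of S}"
proof -
  have iff: "f x extreme_point_of (f ` S) \<longleftrightarrow> x extreme_point_of S" for x
    using face_of_linear_image[OF assms, of "{x}" S] by (simp add: face_of_singleton)
  have "\<exists>y. x = f y" if "x extreme_point_of (f ` S)" for x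
    using that by (auto simp: extreme_point_of_def)
  thus ?thesis using iff by blast
qed

lemma card_extreme_points_facet:
  assumes r: "r > 0" and v: "v \<in> X24"
  shows "card {x. x extreme_point_of {y \<in> (\<lambda>y. r *\<^sub>R y) ` cell24. v \<bullet> y = r}} = 6"
proof -
  let ?F = "{y \<in> cell24. v \<bullet> y = 1}"
  have "{y \<in> (\<lambda>y. r *\<^sub>R y) ` cell24. v \<bullet> y = r} = (\<lambda>y. r *\<^sub>R y) ` ?F"
  proof (intro equalityI subsetI)
    fix y assume "y \<in> {y \<in> (\<lambda>y. r *\<^sub>R y) ` cell24. v \<bullet> y = r}"
    then obtain x where x: "x \<in> cell24" "y = r *\<^sub>R x" and "v \<bullet> y = r" by blast
    hence "v \<bullet> x = 1" using r by simp
    thus "y \<in> (\<lambda>y. r *\<^sub>R y) ` ?F" using x by blast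
  qed auto
  moreover have ex: "{x. x extreme_point_of ?F} = {w \<in> d4_roots. v \<bullet> w = 1}"
  proof -
    have "?F = cell24 \<inter> {y. v \<bullet> y = 1}" by auto
    moreover have "\<And>y. y \<in> cell24 \<Longrightarrow> v \<bullet> y \<le> 1" using v by (auto simp: cell24_def)
    ultimately have face: "?F face_of cell24"
      using face_of_Int_supporting_hyperplane_le[OF convex_cell24, of v 1] by simp
    have "x extreme_point_of ?F \<longleftrightarrow> x \<in> d4_roots \<and> x \<in> ?F" for x
      unfolding extreme_point_of_face[OF face] extreme_point_of_cell24 ..
    thus ?thesis using d4_roots_subset_cell24 by auto
  qed
  moreover have "{x. x extreme_point_of ((\<lambda>y. r *\<^sub>R y) ` ?F)} = (\<lambda>y. r *\<^sub>R y) ` {x. x extreme_point_of ?F}"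
    by (rule extreme_points_of_linear_image) (use r in \<open>auto simp: inj_on_def\<close>)
  ultimately have "card {x. x extreme_point_of {y \<in> (\<lambda>y. r *\<^sub>R y) ` cell24. v \<bullet> y = r}}
      = card ((\<lambda>y. r *\<^sub>R y) ` {w \<in> d4_roots. v \<bullet> w = 1})" by simp
  also have "\<dots> = card {w \<in> d4_roots. v \<bullet> w = 1}"
    by (rule card_image) (use r in \<open>auto simp: inj_on_def\<close>)
  finally show ?thesis using card_d4_roots_on_facet[OF v] by simp
qed

theorem proposition9p2:
  fixes P :: "(real^4) set"
  assumes "minkowski_polytope X24 P"
    and "steiner_point P = 0"
  shows "centered_inradius P / centered_circumradius P = eta_5_4
    \<and> eta_5_4 = 1 / sqrt 2
    \<and> orthogonal_matrix U24
    \<and> (\<exists>c>0. polar_body P = (\<lambda>y. c *\<^sub>R (U24 *v y)) ` P)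
    \<and> gaussian_rule coord_measure [(- 1 / sqrt 2, 1/4), (0, 1/2), (1 / sqrt 2, 1/4)]
    \<and> (\<forall>x\<in>X24.
        realizes_rule X24 (\<lambda>y. (U24 *v x) \<bullet> y)
          [(- 1 / sqrt 2, 1/4), (0, 1/2), (1 / sqrt 2, 1/4)]
        \<and> card {y \<in> X24. (U24 *v x) \<bullet> y = - 1 / sqrt 2} = 6
        \<and> card {y \<in> X24. (U24 *v x) \<bullet> y = 0} = 12
        \<and> card {y \<in> X24. (U24 *v x) \<bullet> y = 1 / sqrt 2} = 6)
    \<and> (\<forall>F. F facet_of P \<longrightarrow> card {v. v extreme_point_of F} = 6)"
proof -
  obtain r where r: "r > 0" and h: "\<And>v. v \<in> X24 \<Longrightarrow> support_fun P v = r"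
    and P: "P = (\<lambda>y. r *\<^sub>R y) ` cell24"
    using minkowski_polytope_X24_is_cell24[OF assms] by blast
  have "centered_inradius P / centered_circumradius P = eta_5_4"
    unfolding P centered_inradius_cell24[OF r] centered_circumradius_cell24[OF r] eta_5_4_eq
    using r by simp
  moreover have "\<exists>c>0. polar_body P = (\<lambda>y. c *\<^sub>R (U24 *v y)) ` P"
    unfolding P polar_body_cell24[OF r] using r by (intro exI[of _ "1 / (r\<^sup>2 * sqrt 2)"]) simp
  moreover have "card {v. v extreme_point_of F} = 6" if F: "F facet_of P" for F
  proof -
    obtain v where "v \<in> X24" "F = {y \<in> P. v \<bullet> y = support_fun P v}"
      using minkowski_polytope_structure(6)[OF assms(1) F] by blast
    thus ?thesis using card_extreme_points_facet[OF r] h P by simp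
  qed
  ultimately show ?thesis
    using eta_5_4_eq orthogonal_matrix_U24 gaussian_rule_coord facet_row_realizes_rule card_facet_row(1-3)
    by blast
qed

end
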